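(* Let $\Phi=(G,\hat{\mathbb V},\varphi)$ be a dual unit gain graph on $n$ vertices. Then $$\mathrm{Mdet}(A(\Phi))=\sum_{B\in\mathcal B_n(G)}(-1)^{n+p(B)}\,2^{c(B)}\,\mathcal R(B).$$ Furthermore, writing the characteristic polynomial of $A(\Phi)$ as $p_{A(\Phi)}(x)=x^n+\sum_{i=1}^n c_ix^{n-i}$, one has $$c_i=\sum_{B\in\mathcal B_i(G)}(-1)^{p(B)}\,2^{c(B)}\,\mathcal R(B),\qquad i=1,\dots,n.$$
   Context: Dual elements: $\mathbb G\in\{\mathbb R,\mathbb C,\mathbb H\}$; $\hat{\mathbb G}=\{a_s+a_d\epsilon:a_s,a_d\in\mathbb G\}$ with $\epsilon\ne0$, $\epsilon^2=0$, $\epsilon$ central, product $(a_s+a_d\epsilon)(b_s+b_d\epsilon)=a_sb_s+(a_sb_d+a_db_s)\epsilon$, conjugate $a^*=a_s^*+a_d^*\epsilon$. The real part is $Re(a)=Re(a_s)+Re(a_d)\epsilon\in\hat{\mathbb R}$ (real part of a quaternion = its scalar part). $\hat{\mathbb V}$ is the group of unit dual elements $p=p_s+p_d\epsilon$ ($|p_s|=1$, $p_sp_d^*+p_dp_s^*=0$). Gain graph: $G=(V,E)$ finite simple graph, $V=\{v_1,\dots,v_n\}$; each edge $v_iv_j$ gives oriented edges $e_{ij},e_{ji}$; $\varphi$ maps them to $\hat{\mathbb V}$ with $\varphi(e_{ji})=\varphi(e_{ij})^{-1}$. $A(\Phi)=(a_{ij})$, $a_{ij}=\varphi(e_{ij})$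 if $v_iv_j\in E$, else $0$. For a cycle $C$ of $G$, $\mathcal R(C)=Re(\varphi(e_{u_1u_2})\varphi(e_{u_2u_3})\cdots\varphi(e_{u_lu_1}))$ where $u_1u_2\cdots u_lu_1$ is a traversal of $C$ (this does not depend on the starting vertex or direction). An elementary graph is $K_2$ or a cycle $C_r$ ($r\ge3$); a basic graph is a disjoint union of elementary graphs. $\mathcal B_i(G)$ is the set of subgraphs of $G$ that are basic graphs on $i$ vertices. For $B$ basic: $p(B)$ = number of components, $c(B)$ = number of cycle components ($C_r$, $r\ge3$), $\mathcal R(B)=\prod_{C}\mathcal R(C)$ over cycle components (empty product $=1$). Moore determinant: for $M=(m_{ij})\in\hat{\mathbb G}^{n\times n}$ and a permutation $\sigma$ of $\{1,\dots,n\}$, write $\sigma$ as a product of disjoint cycles (fixed points included) $\sigma=(n_{11}\cdots n_{1l_1})\cdots(n_{r1}\cdots n_{rl_r})$ with $n_{i1}<n_{ij}$ for $j>1$ and $n_{11}>n_{21}>\cdots>n_{r1}$; set $m_\sigma=(m_{n_{11}n_{12}}m_{n_{12}n_{13}}\cdots m_{n_{1l_1}n_{11}})\cdots(m_{n_{r1}n_{r2}}\cdots m_{n_{rl_r}n_{r1}})$ and $\mathrm{Mdet}(M)=\sum_\sigma \mathrm{sgn}(\sigma)m_\sigma$. The characteristic polynomial is $p_{A(\Phi)}(x)=\mathrm{Mdet}(xI_n-A(\Phi))$ with $x$ a central indeterminate. *)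

theory Defs
  imports "HOL-Analysis.Product_Vector" "HOL-Library.Poly_Mapping" "HOL-Combinatorics.Cycles"
begin

section \<open>Quaternions\<close>

datatype quat = Quat (qre: real) (qi: real) (qj: real) (qk: real)

lemma quat_eq_iff:
  "x = y \<longleftrightarrow> qre x = qre y \<and> qi x = qi y \<and> qj x = qj y \<and> qk x = qk y"
  by (cases x; cases y) simp

instantiation quat :: ring_1
begin

definition "0 = Quat 0 0 0 0"
definition "1 = Quat 1 0 0 0"
definition "x + y = Quat (qre x + qre y) (qi x + qi y) (qj x + qj y) (qk x + qk y)"
definition "- x = Quat (- qre x) (- qi x) (- qj x) (- qk x)"
definition "x - y = Quat (qre x - qre y) (qi x - qi y) (qj x - qj y) (qk x - qk y)"
definition "x * y = Quat
   (qre x * qre y - qi x * qi y - qj x * qj y - qk x * qk y)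
   (qre x * qi y + qi x * qre y + qj x * qk y - qk x * qj y)
   (qre x * qj y - qi x * qk y + qj x * qre y + qk x * qi y)
   (qre x * qk y + qi x * qj y - qj x * qi y + qk x * qre y)"

instance
  by standard
    (simp_all add: zero_quat_def one_quat_def plus_quat_def uminus_quat_def minus_quat_def
      times_quat_def algebra_simps)

end

lemma quat_sel [simp]:
  "qre 0 = 0" "qi 0 = 0" "qj 0 = 0" "qk 0 = 0"
  "qre 1 = 1" "qi 1 = 0" "qj 1 = 0" "qk 1 = 0"
  "qre (x + y) = qre x + qre y" "qi (x + y) = qi x + qi y"
  "qj (x + y) = qj x + qj y" "qk (x + y) = qk x + qk y"
  "qre (- x) = - qre x" "qi (- x) = - qi x" "qj (- x) = - qj x" "qk (- x) = - qk x"
  "qre (x - y) = qre x - qre y" "qi (x - y) = qi x - qi y"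
  "qj (x - y) = qj x - qj y" "qk (x - y) = qk x - qk y"
  "qre (x * y) = qre x * qre y - qi x * qi y - qj x * qj y - qk x * qk y"
  "qi (x * y) = qre x * qi y + qi x * qre y + qj x * qk y - qk x * qj y"
  "qj (x * y) = qre x * qj y - qi x * qk y + qj x * qre y + qk x * qi y"
  "qk (x * y) = qre x * qk y + qi x * qj y - qj x * qi y + qk x * qre y"
  by (simp_all add: zero_quat_def one_quat_def plus_quat_def uminus_quat_def minus_quat_def
      times_quat_def)

definition qnorm2 :: "quat \<Rightarrow> real" where
  "qnorm2 x = (qre x)\<^sup>2 + (qi x)\<^sup>2 + (qj x)\<^sup>2 + (qk x)\<^sup>2"

lemma qnorm2_nonneg [simp]: "0 \<le> qnorm2 x"
  by (simp add: qnorm2_def)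

lemma qnorm2_eq_0 [simp]: "qnorm2 x = 0 \<longleftrightarrow> x = 0"
  by (simp add: qnorm2_def quat_eq_iff add_nonneg_eq_0_iff)

lemma qnorm2_mult: "qnorm2 (x * y) = qnorm2 x * qnorm2 y"
  by (simp add: qnorm2_def power2_eq_square algebra_simps)

instantiation quat :: real_algebra_1
begin

definition "scaleR r x = Quat (r * qre x) (r * qi x) (r * qj x) (r * qk x)"

instance
  by standard (simp_all add: quat_eq_iff scaleR_quat_def algebra_simps)

end

instantiation quat :: real_normed_div_algebra
begin

definition "inverse x =
  Quat (qre x / qnorm2 x) (- qi x / qnorm2 x) (- qj x / qnorm2 x) (- qk x / qnorm2 x)"
definition "x div y = x * inverse y" for x y :: quat
definition "norm x = sqrt (qnorm2 x)"
definition "sgn x = x /\<^sub>R norm x" for x :: quat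
definition "dist x y = norm (x - y)" for x y :: quat
definition "(uniformity :: (quat \<times> quat) filter) =
  (INF e\<in>{0 <..}. principal {(x, y). dist x y < e})"
definition "open (U :: quat set) \<longleftrightarrow>
  (\<forall>x\<in>U. eventually (\<lambda>(x', y). x' = x \<longrightarrow> y \<in> U) uniformity)"

instance
proof
  fix r s :: real and x y z :: quat and S :: "quat set"
  show "inverse x * x = 1" "x * inverse x = 1" if "x \<noteq> 0"
  proof -
    have "qre x / qnorm2 x * qre x + qi x / qnorm2 x * qi x + qj x / qnorm2 x * qj x
        + qk x / qnorm2 x * qk x
      = (qre x * qre x + qi x * qi x + qj x * qj x + qk x * qk x) / qnorm2 x"
      by (simp add: add_divide_distrib)
    also have "\<dots> = qnorm2 x / qnorm2 x"
      by (simp only: qnorm2_def power2_eq_square)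
    finally have "qre x / qnorm2 x * qre x + qi x / qnorm2 x * qi x + qj x / qnorm2 x * qj x
      + qk x / qnorm2 x * qk x = qnorm2 x / qnorm2 x" .
    with that show "inverse x * x = 1" "x * inverse x = 1"
      unfolding quat_eq_iff[of _ 1] by (simp_all add: inverse_quat_def mult.commute)
  qed
  show "inverse (0 :: quat) = 0"
    by (simp add: quat_eq_iff inverse_quat_def)
  show "norm x = 0 \<longleftrightarrow> x = 0"
    by (simp add: norm_quat_def)
  have n: "norm w = norm (Complex (qre w) (qi w), Complex (qj w) (qk w))" for w :: quat
    by (simp add: norm_quat_def qnorm2_def norm_prod_def norm_complex_def)
  show "norm (x + y) \<le> norm x + norm y"
    using norm_triangle_ineq[of "(Complex (qre x) (qi x), Complex (qj x) (qk x))"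
        "(Complex (qre y) (qi y), Complex (qj y) (qk y))"]
    by (simp add: n complex_add)
  have "qnorm2 (r *\<^sub>R x) = r\<^sup>2 * qnorm2 x"
    by (simp add: qnorm2_def scaleR_quat_def power2_eq_square algebra_simps)
  then show "norm (r *\<^sub>R x) = \<bar>r\<bar> * norm x"
    by (simp add: norm_quat_def real_sqrt_mult)
  show "norm (x * y) = norm x * norm y"
    by (simp add: norm_quat_def qnorm2_mult real_sqrt_mult)
qed (rule divide_quat_def sgn_quat_def dist_quat_def open_quat_def uniformity_quat_def)+

end

lemma quat_of_real_sel [simp]:
  "qre (of_real r) = r" "qi (of_real r) = 0" "qj (of_real r) = 0" "qk (of_real r) = 0"
  by (simp_all add: of_real_def scaleR_quat_def)


section \<open>The scalar domains \<open>\<real>\<close>, \<open>\<complex>\<close>, \<open>\<H>\<close>\<close>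

text \<open>
  By the theorem of Frobenius, the models of this class are, up to isomorphism, exactly the
  reals, the complex numbers and the quaternions: the last two axioms say that every \<open>x\<close> is a
  root of \<open>t\<^sup>2 - 2 sre x t + |x|\<^sup>2\<close>, which also forces \<open>sconj\<close>, \<open>sre\<close> and the norm to be the
  usual ones.
\<close>

class gain_scalar = real_normed_div_algebra +
  fixes sconj :: "'a \<Rightarrow> 'a"
    and sre :: "'a \<Rightarrow> real"
  assumes sconj_add: "sconj (x + y) = sconj x + sconj y"
    and sconj_mult: "sconj (x * y) = sconj y * sconj x"
    and mult_sconj: "x * sconj x = (norm x)\<^sup>2 *\<^sub>R 1"
    and add_sconj: "x + sconj x = (2 * sre x) *\<^sub>R 1"

instantiation real :: gain_scalar
begin
definition "sconj x = x" for x :: real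
definition "sre x = x" for x :: real
instance by standard (simp_all add: sconj_real_def sre_real_def power2_eq_square)
end

instantiation complex :: gain_scalar
begin
definition "sconj x = cnj x" for x :: complex
definition "sre x = Re x" for x :: complex
instance
proof
  fix x y :: complex
  show "x * sconj x = (norm x)\<^sup>2 *\<^sub>R 1"
    by (simp add: sconj_complex_def complex_mult_cnj cmod_power2 scaleR_conv_of_real)
qed (simp_all add: sconj_complex_def sre_complex_def complex_eq_iff)
end

instantiation quat :: gain_scalar
begin
definition "sconj x = Quat (qre x) (- qi x) (- qj x) (- qk x)" for x :: quat
definition "sre x = qre x" for x :: quat
instance
proof
  fix x y :: quat
  have "(norm x)\<^sup>2 = qnorm2 x"
    by (simp add: norm_quat_def)
  then show "x * sconj x = (norm x)\<^sup>2 *\<^sub>R 1"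
    by (simp add: sconj_quat_def quat_eq_iff scaleR_quat_def qnorm2_def power2_eq_square)
  show "sconj (x * y) = sconj y * sconj x"
    unfolding quat_eq_iff by (simp add: sconj_quat_def mult.commute)
qed (simp_all add: sconj_quat_def sre_quat_def quat_eq_iff scaleR_quat_def)
end


section \<open>Dual elements\<close>

datatype 'a dual = Dual (std: 'a) (dul: 'a)

lemma dual_eq_iff: "x = y \<longleftrightarrow> std x = std y \<and> dul x = dul y"
  by (cases x; cases y) simp

instantiation dual :: (ring_1) ring_1
begin

definition "0 = Dual 0 0"
definition "1 = Dual 1 0"
definition "x + y = Dual (std x + std y) (dul x + dul y)"
definition "- x = Dual (- std x) (- dul x)"
definition "x - y = Dual (std x - std y) (dul x - dul y)"
definition "x * y = Dual (std x * std y) (std x * dul y + dul x * std y)"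

instance
proof
  fix a b c :: "'a dual"
  show "a * b * c = a * (b * c)" by (simp add: times_dual_def algebra_simps)
  show "(a + b) + c = a + (b + c)" by (simp add: plus_dual_def algebra_simps)
  show "a + b = b + a" by (simp add: plus_dual_def algebra_simps)
  show "0 + a = a" by (simp add: plus_dual_def zero_dual_def)
  show "- a + a = 0" by (simp add: plus_dual_def zero_dual_def uminus_dual_def)
  show "a - b = a + - b" by (simp add: plus_dual_def minus_dual_def uminus_dual_def)
  show "(a + b) * c = a * c + b * c" by (simp add: times_dual_def plus_dual_def algebra_simps)
  show "a * (b + c) = a * b + a * c" by (simp add: times_dual_def plus_dual_def algebra_simps)
  show "1 * a = a" by (simp add: times_dual_def one_dual_def)
  show "a * 1 = a" by (simp add: times_dual_def one_dual_def)
  show "(0::'a dual) \<noteq> 1" by (simp add: zero_dual_def one_dual_def)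
qed

end

instance dual :: (comm_ring_1) comm_ring_1
proof
  fix a b :: "'a dual"
  show "a * b = b * a"
    by (simp add: times_dual_def mult.commute add.commute)
qed (simp_all add: distrib_right)

definition dual_re :: "'a::gain_scalar dual \<Rightarrow> real dual" where
  "dual_re a = Dual (sre (std a)) (sre (dul a))"

definition of_real_dual :: "real dual \<Rightarrow> 'a::gain_scalar dual" where
  "of_real_dual a = Dual (of_real (std a)) (of_real (dul a))"

definition unit_dual :: "'a::gain_scalar dual \<Rightarrow> bool" where
  "unit_dual p \<longleftrightarrow> norm (std p) = 1 \<and> std p * sconj (dul p) + dul p * sconj (std p) = 0"


section \<open>Graphs\<close>

type_synonym 'v graph = "'v set \<times> 'v set set"

abbreviation verts :: "'v graph \<Rightarrow> 'v set" where "verts \<equiv> fst"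
abbreviation edges :: "'v graph \<Rightarrow> 'v set set" where "edges \<equiv> snd"

definition simple_graph :: "'v graph \<Rightarrow> bool" where
  "simple_graph G \<longleftrightarrow> finite (verts G) \<and> (\<forall>e\<in>edges G. e \<subseteq> verts G \<and> card e = 2)"

definition subgraph :: "'v graph \<Rightarrow> 'v graph \<Rightarrow> bool" where
  "subgraph H G \<longleftrightarrow> simple_graph H \<and> verts H \<subseteq> verts G \<and> edges H \<subseteq> edges G"

definition component_of :: "'v graph \<Rightarrow> 'v \<Rightarrow> 'v graph" where
  "component_of G v =
     (let W = {w. (v, w) \<in> {(x, y). {x, y} \<in> edges G}\<^sup>*} in (W, {e \<in> edges G. e \<subseteq> W}))"

definition components :: "'v graph \<Rightarrow> 'v graph set" where
  "components G = component_of G ` verts G"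

definition is_K2 :: "'v graph \<Rightarrow> bool" where
  "is_K2 G \<longleftrightarrow> (\<exists>u v. u \<noteq> v \<and> G = ({u, v}, {{u, v}}))"

definition traversal :: "'v list \<Rightarrow> 'v graph \<Rightarrow> bool" where
  "traversal us C \<longleftrightarrow> distinct us \<and> length us \<ge> 3 \<and>
     C = (set us, {{us ! k, us ! (Suc k mod length us)} | k. k < length us})"

definition is_cycle :: "'v graph \<Rightarrow> bool" where
  "is_cycle C \<longleftrightarrow> (\<exists>us. traversal us C)"

definition elementary_graph :: "'v graph \<Rightarrow> bool" where
  "elementary_graph G \<longleftrightarrow> is_K2 G \<or> is_cycle G"

definition basic_graph :: "'v graph \<Rightarrow> bool" where
  "basic_graph B \<longleftrightarrow> (\<exists>\<C>. (\<forall>C\<in>\<C>. elementary_graph C) \<and>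
     (\<forall>C\<in>\<C>. \<forall>D\<in>\<C>. C \<noteq> D \<longrightarrow> verts C \<inter> verts D = {}) \<and>
     B = (\<Union>C\<in>\<C>. verts C, \<Union>C\<in>\<C>. edges C))"

definition basic_subgraphs :: "nat \<Rightarrow> 'v graph \<Rightarrow> 'v graph set" where
  "basic_subgraphs i G = {B. subgraph B G \<and> basic_graph B \<and> card (verts B) = i}"

definition num_components :: "'v graph \<Rightarrow> nat" where
  "num_components B = card (components B)"

definition num_cycles :: "'v graph \<Rightarrow> nat" where
  "num_cycles B = card {C \<in> components B. is_cycle C}"


section \<open>Dual unit gain graphs\<close>

text \<open>
  The gain of the oriented edge from \<open>i\<close> to \<open>j\<close> is \<open>\<phi> i j\<close>; the values of \<open>\<phi>\<close> at
  non-adjacent pairs are irrelevant.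
\<close>

definition dual_unit_gain_graph ::
  "'v graph \<Rightarrow> ('v \<Rightarrow> 'v \<Rightarrow> 'a::gain_scalar dual) \<Rightarrow> bool" where
  "dual_unit_gain_graph G \<phi> \<longleftrightarrow> simple_graph G \<and>
     (\<forall>i j. {i, j} \<in> edges G \<longrightarrow>
        unit_dual (\<phi> i j) \<and> \<phi> i j * \<phi> j i = 1 \<and> \<phi> j i * \<phi> i j = 1)"

definition gain_adjacency ::
  "'v graph \<Rightarrow> ('v \<Rightarrow> 'v \<Rightarrow> 'a::gain_scalar dual) \<Rightarrow> 'v \<Rightarrow> 'v \<Rightarrow> 'a dual" where
  "gain_adjacency G \<phi> i j = (if {i, j} \<in> edges G then \<phi> i j else 0)"

text \<open>\<open>m u\<^sub>1 u\<^sub>2 * m u\<^sub>2 u\<^sub>3 * \<dots> * m u\<^sub>l u\<^sub>1\<close>, in this order, for \<open>us = [u\<^sub>1, \<dots>, u\<^sub>l]\<close>.\<close>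

definition cyclic_prod :: "('v \<Rightarrow> 'v \<Rightarrow> 'b::monoid_mult) \<Rightarrow> 'v list \<Rightarrow> 'b" where
  "cyclic_prod m us =
     prod_list (map (\<lambda>k. m (us ! k) (us ! (Suc k mod length us))) [0..<length us])"

definition cycle_re :: "('v \<Rightarrow> 'v \<Rightarrow> 'a::gain_scalar dual) \<Rightarrow> 'v graph \<Rightarrow> real dual" where
  "cycle_re \<phi> C = dual_re (cyclic_prod \<phi> (SOME us. traversal us C))"

definition basic_re :: "('v \<Rightarrow> 'v \<Rightarrow> 'a::gain_scalar dual) \<Rightarrow> 'v graph \<Rightarrow> real dual" where
  "basic_re \<phi> B = (\<Prod>C \<in> {C \<in> components B. is_cycle C}. cycle_re \<phi> C)"


section \<open>The Moore determinant\<close>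

text \<open>
  Matrices of order \<open>n\<close> are functions whose indices range over \<open>{1..n}\<close>.  Each cycle of \<open>\<sigma>\<close>
  (fixed points included) is listed from its least element, by iterating \<open>\<sigma>\<close>, and the cycles
  are taken in decreasing order of their least elements.
\<close>

definition cycle_leaders :: "nat \<Rightarrow> (nat \<Rightarrow> nat) \<Rightarrow> nat list" where
  "cycle_leaders n \<sigma> = rev (sorted_list_of_set {a \<in> {1..n}. \<forall>b \<in> set (support \<sigma> a). a \<le> b})"

definition moore_term :: "nat \<Rightarrow> (nat \<Rightarrow> nat \<Rightarrow> 'b::ring_1) \<Rightarrow> (nat \<Rightarrow> nat) \<Rightarrow> 'b" where
  "moore_term n M \<sigma> = prod_list (map (\<lambda>a. cyclic_prod M (support \<sigma> a)) (cycle_leaders n \<sigma>))"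

definition Mdet :: "nat \<Rightarrow> (nat \<Rightarrow> nat \<Rightarrow> 'b::ring_1) \<Rightarrow> 'b" where
  "Mdet n M = (\<Sum>\<sigma> | \<sigma> permutes {1..n}. of_int (sign \<sigma>) * moore_term n M \<sigma>)"

text \<open>
  Polynomials in a central indeterminate over a possibly noncommutative ring \<open>'b\<close> are
  elements of the monoid ring \<open>nat \<Rightarrow>\<^sub>0 'b\<close>, since \<open>'b poly\<close> is a ring only for commutative \<open>'b\<close>.
\<close>

definition poly_const :: "'b::ring_1 \<Rightarrow> (nat \<Rightarrow>\<^sub>0 'b)" where
  "poly_const a = Poly_Mapping.single 0 a"

definition poly_X :: "nat \<Rightarrow>\<^sub>0 'b::ring_1" where
  "poly_X = Poly_Mapping.single 1 1"

definition moore_charpoly :: "nat \<Rightarrow> (nat \<Rightarrow> nat \<Rightarrow> 'b::ring_1) \<Rightarrow> (nat \<Rightarrow>\<^sub>0 'b)" where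
  "moore_charpoly n A = Mdet n (\<lambda>i j. (if i = j then poly_X else 0) - poly_const (A i j))"

end

theory Submission
  imports Defs
begin

text \<open>
  Both sides of the determinant formula satisfy the same recursion.  In the Moore ordering the
  cycle through the least index \<open>m\<close> of the index set \<open>S\<close> is the last factor, so splitting it off
  gives \<open>Mdet S = (\<Sum>T. Mdet (S - T) * c T)\<close>, where \<open>c T\<close> is the signed sum of the products
  along all cyclic orders of \<open>T\<close>, started at \<open>m\<close>.  Basic graphs split in the same way into the
  component at \<open>m\<close> and the rest.  It remains to compare \<open>c T\<close> with the elementary graphs on
  \<open>T\<close>: a cycle graph has exactly two traversals from \<open>m\<close>, with conjugate gains \<open>g\<close> and \<open>g\<^sup>*\<close>,
  and \<open>g + g\<^sup>* = 2 Re g\<close> is central, so noncommutativity plays no role beyond a single cycle.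
  The determinant and the characteristic polynomial are the instances \<open>x = 0\<close>, \<open>s = -1\<close> and
  \<open>x\<close> an indeterminate, \<open>s = 1\<close> of the expansion of the Moore determinant of \<open>x I - s A\<close>.
\<close>

section \<open>Splitting off the cycle through the least index\<close>

definition mdet_on :: "nat set \<Rightarrow> (nat \<Rightarrow> nat \<Rightarrow> 'b::ring_1) \<Rightarrow> 'b" where
  "mdet_on S M = (\<Sum>\<sigma> | \<sigma> permutes S. of_int (sign \<sigma>) *
     prod_list (map (\<lambda>a. cyclic_prod M (support \<sigma> a))
       (rev (sorted_list_of_set {a \<in> S. \<forall>b \<in> set (support \<sigma> a). a \<le> b}))))"

lemma Mdet_eq_mdet_on: "Mdet n M = mdet_on {1..n} M"
  by (simp add: Mdet_def mdet_on_def moore_term_def cycle_leaders_def)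

lemma mdet_on_empty: "mdet_on {} M = 1"
  by (simp add: mdet_on_def sign_id)

definition cycle_sum :: "(nat \<Rightarrow> nat \<Rightarrow> 'b::ring_1) \<Rightarrow> nat \<Rightarrow> nat set \<Rightarrow> 'b" where
  "cycle_sum M m T = (\<Sum>us | distinct us \<and> us \<noteq> [] \<and> hd us = m \<and> set us = T.
     (- 1) ^ (length us - 1) * cyclic_prod M us)"

lemma finite_distinct_lists: "finite T \<Longrightarrow> finite {us. distinct us \<and> P us \<and> set us \<subseteq> T}"
  by (rule finite_subset[OF _ finite_subset_distinct[of T]]) auto

lemma support_cong:
  assumes "\<And>i. (p ^^ i) a = (q ^^ i) a"
  shows "support p a = support q a"
  by (simp add: least_power_def assms)

lemma sign_cycle_of_list:
  "distinct us \<Longrightarrow> sign (cycle_of_list us) = (- 1) ^ (length us - 1)"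
  by (induct us rule: cycle_of_list.induct)
    (simp_all add: sign_compose permutation_swap_id permutation_of_cycle sign_swap_id)

lemma support_cycle_of_list:
  assumes "distinct us" "us \<noteq> []"
  shows "support (cycle_of_list us) (hd us) = us"
proof -
  let ?c = "cycle_of_list us" and ?l = "length us"
  have l: "?l > 0" using assms by simp
  have pow: "(?c ^^ i) (hd us) = us ! (i mod ?l)" for i
  proof -
    have "(?c ^^ i) (us ! 0) = map (?c ^^ i) us ! 0" using l by simp
    also have "\<dots> = rotate i us ! 0" using cyclic_rotation[OF assms(1)] by simp
    also have "\<dots> = us ! (i mod ?l)" using l by (simp add: nth_rotate)
    finally show ?thesis using assms by (simp add: hd_conv_nth)
  qed
  have "least_power ?c (hd us) = ?l"
    unfolding least_power_def
  proof (rule Least_equality)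
    show "(?c ^^ ?l) (hd us) = hd us \<and> ?l > 0"
      using assms l pow[of ?l] by (simp add: hd_conv_nth)
    fix k assume k: "(?c ^^ k) (hd us) = hd us \<and> k > 0"
    then have "us ! (k mod ?l) = us ! 0" using assms pow[of k] by (simp add: hd_conv_nth)
    then have "k mod ?l = 0" using assms l by (simp add: nth_eq_iff_index_eq)
    then show "?l \<le> k" using k by (auto intro: dvd_imp_le)
  qed
  then show ?thesis
    by (intro nth_equalityI) (simp_all add: pow)
qed

lemma funpow_comp_disjoint:
  assumes "p permutes A" "q permutes B" "A \<inter> B = {}"
  shows "a \<notin> B \<Longrightarrow> ((p \<circ> q) ^^ i) a = (p ^^ i) a"
    and "a \<notin> A \<Longrightarrow> ((p \<circ> q) ^^ i) a = (q ^^ i) a"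
proof -
  show "((p \<circ> q) ^^ i) a = (p ^^ i) a" if "a \<notin> B"
  proof (cases "a \<in> A")
    case True
    have "(p ^^ i) a \<in> A" for i
      using permutes_in_image[OF permutes_funpow[OF assms(1)]] True by blast
    then have "(p ^^ i) a \<notin> B" for i using assms(3) by blast
    then show ?thesis using assms(2) by (induct i) (simp_all add: permutes_not_in)
  next
    case False
    have "((p \<circ> q) ^^ i) a = a" using that False assms by (induct i) (simp_all add: permutes_not_in)
    moreover have "(p ^^ i) a = a" using False assms by (induct i) (simp_all add: permutes_not_in)
    ultimately show ?thesis by simp
  qed
  show "((p \<circ> q) ^^ i) a = (q ^^ i) a" if "a \<notin> A"
  proof (cases "a \<in> B")
    case True
    have "(q ^^ i) a \<in> B" for i
      using permutes_in_image[OF permutes_funpow[OF assms(2)]] True by blast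
    then have "(q ^^ i) a \<notin> A" for i using assms(3) by blast
    then have "p ((q ^^ i) a) = (q ^^ i) a" for i using assms(1) by (simp add: permutes_not_in)
    from this[of "Suc _"] show ?thesis by (induct i) simp_all
  next
    case False
    have "((p \<circ> q) ^^ i) a = a" using that False assms by (induct i) (simp_all add: permutes_not_in)
    moreover have "(q ^^ i) a = a" using False assms by (induct i) (simp_all add: permutes_not_in)
    ultimately show ?thesis by simp
  qed
qed

lemma moore_summand_comp_cycle:
  fixes M :: "nat \<Rightarrow> nat \<Rightarrow> 'b::ring_1"
  assumes S: "finite S" "m \<in> S" "\<And>a. a \<in> S \<Longrightarrow> m \<le> a"
    and us: "distinct us" "us \<noteq> []" "hd us = m" "set us \<subseteq> S"
    and \<tau>: "\<tau> permutes S - set us"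
  defines "\<sigma> \<equiv> \<tau> \<circ> cycle_of_list us"
  shows "of_int (sign \<sigma>) * prod_list (map (\<lambda>a. cyclic_prod M (support \<sigma> a))
       (rev (sorted_list_of_set {a \<in> S. \<forall>b \<in> set (support \<sigma> a). a \<le> b}))) =
     of_int (sign \<tau>) * prod_list (map (\<lambda>a. cyclic_prod M (support \<tau> a))
       (rev (sorted_list_of_set {a \<in> S - set us. \<forall>b \<in> set (support \<tau> a). a \<le> b}))) *
     ((- 1) ^ (length us - 1) * cyclic_prod M us)" (is ?L)
    and "support \<sigma> m = us"
    and "\<sigma> permutes S"
proof -
  have cp: "cycle_of_list us permutes set us" by (rule cycle_permutes)
  have m: "m \<in> set us" using us by auto
  have dj: "(S - set us) \<inter> set us = {}" by blast
  show perm: "\<sigma> permutes S" unfolding \<sigma>_def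
    by (rule permutes_compose) (auto intro: permutes_subset[OF cp us(4)] permutes_subset[OF \<tau>])
  have "permutation \<tau>" using \<tau> S by (auto simp: permutation_permutes)
  then have sg: "sign \<sigma> = sign \<tau> * (- 1) ^ (length us - 1)"
    unfolding \<sigma>_def by (simp add: sign_compose permutation_of_cycle sign_cycle_of_list us)
  have sm: "support \<sigma> a = support (cycle_of_list us) a" if "a \<in> set us" for a
    by (rule support_cong) (use that in \<open>simp add: \<sigma>_def funpow_comp_disjoint(2)[OF \<tau> cp dj]\<close>)
  from sm[OF m] show sm': "support \<sigma> m = us" using support_cycle_of_list[OF us(1,2)] us(3) by simp
  have st: "support \<sigma> a = support \<tau> a" if "a \<in> S - set us" for a
    by (rule support_cong) (use that in \<open>simp add: \<sigma>_def funpow_comp_disjoint(1)[OF \<tau> cp dj]\<close>)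
  have ps: "permutation \<sigma>" using perm S by (auto simp: permutation_permutes)
  have notl: "\<not> (\<forall>b \<in> set (support \<sigma> a). a \<le> b)" if "a \<in> set us" "a \<noteq> m" for a
  proof -
    have "a \<in> set (support \<sigma> m)" using sm' that by simp
    then have "set (support \<sigma> a) \<inter> set (support \<sigma> m) \<noteq> {}" using disjoint_support'[OF ps] by blast
    then have "set (support \<sigma> m) \<inter> set (support \<sigma> a) \<noteq> {}" by blast
    then have "m \<in> set (support \<sigma> a)" using disjoint_support'[OF ps] by blast
    moreover have "m < a" using S(3)[of a] that us(4) by force
    ultimately show ?thesis by (meson leD)
  qed
  let ?A = "{a \<in> S - set us. \<forall>b \<in> set (support \<tau> a). a \<le> b}"
  have lead: "m \<in> {a \<in> S. \<forall>b \<in> set (support \<sigma> a). a \<le> b}"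
    using S us(4) unfolding mem_Collect_eq sm' by blast
  have "{a \<in> S. \<forall>b \<in> set (support \<sigma> a). a \<le> b} = insert m ?A"
  proof (rule set_eqI)
    fix a show "a \<in> {a \<in> S. \<forall>b \<in> set (support \<sigma> a). a \<le> b} \<longleftrightarrow> a \<in> insert m ?A"
    proof (cases "a \<in> set us")
      case True then show ?thesis using lead notl by blast
    next
      case False
      then have "a \<noteq> m" using m by blast
      show ?thesis
      proof (cases "a \<in> S")
        case True
        then have *: "support \<sigma> a = support \<tau> a" using st False by blast
        show ?thesis using False \<open>a \<noteq> m\<close> unfolding mem_Collect_eq insert_iff Diff_iff * by blast
      next
        case False then show ?thesis using \<open>a \<noteq> m\<close> by blast
      qed
    qed
  qed
  moreover have "sorted_list_of_set (insert m ?A) = m # sorted_list_of_set ?A"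
  proof -
    have "finite ?A" "m \<notin> ?A" using S m by auto
    then have "sorted_list_of_set (insert m ?A) = insort m (sorted_list_of_set ?A)" by simp
    also have "\<dots> = m # sorted_list_of_set ?A" 
      by (rule insort_is_Cons) (use S \<open>finite ?A\<close> in auto)
    finally show ?thesis .
  qed
  ultimately have lead_eq: "rev (sorted_list_of_set {a \<in> S. \<forall>b \<in> set (support \<sigma> a). a \<le> b})
      = rev (sorted_list_of_set ?A) @ [m]" by simp
  have map_eq: "map (\<lambda>a. cyclic_prod M (support \<sigma> a)) (rev (sorted_list_of_set ?A))
      = map (\<lambda>a. cyclic_prod M (support \<tau> a)) (rev (sorted_list_of_set ?A))"
  proof (rule map_cong[OF refl])
    fix a assume "a \<in> set (rev (sorted_list_of_set ?A))"
    moreover have "finite ?A" using S by simp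
    ultimately have "a \<in> ?A" by (simp only: set_rev set_sorted_list_of_set)
    then have "a \<in> S - set us" by blast
    then show "cyclic_prod M (support \<sigma> a) = cyclic_prod M (support \<tau> a)" by (simp only: st)
  qed
  have c: "(- 1) ^ k * (p::'b) = p * (- 1) ^ k" for k p
    by (induct k) simp_all
  show ?L
    unfolding lead_eq map_append prod_list.append map_eq sg
    by (simp only: list.map prod_list.Cons prod_list.Nil sm' of_int_mult of_int_power of_int_minus
        of_int_1 mult_1_right mult.assoc c)
qed

lemma mdet_on_rec:
  fixes M :: "nat \<Rightarrow> nat \<Rightarrow> 'b::ring_1"
  assumes S: "finite S" "m \<in> S" "\<And>a. a \<in> S \<Longrightarrow> m \<le> a"
  shows "mdet_on S M = (\<Sum>T | T \<subseteq> S \<and> m \<in> T. mdet_on (S - T) M * cycle_sum M m T)"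
proof -
  let ?lead = "\<lambda>S \<sigma>. rev (sorted_list_of_set {a \<in> S. \<forall>b \<in> set (support \<sigma> a). a \<le> b})"
  let ?t = "\<lambda>S \<sigma>. of_int (sign \<sigma>) * prod_list (map (\<lambda>a. cyclic_prod M (support \<sigma> a)) (?lead S \<sigma>))"
  let ?U = "{us. distinct us \<and> us \<noteq> [] \<and> hd us = m \<and> set us \<subseteq> S}"
  let ?P = "\<lambda>us. {\<tau>. \<tau> permutes S - set us}"
  let ?g = "\<lambda>us. (- 1) ^ (length us - 1) * cyclic_prod M us"
  have finU: "finite ?U"
    using finite_distinct_lists[OF S(1), of "\<lambda>us. us \<noteq> [] \<and> hd us = m"] by simp
  have "mdet_on S M = (\<Sum>(us, \<tau>) \<in> Sigma ?U ?P. ?t (S - set us) \<tau> * ?g us)"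
    unfolding mdet_on_def
  proof (rule sum.reindex_bij_witness[where
        i = "\<lambda>(us, \<tau>). \<tau> \<circ> cycle_of_list us" and
        j = "\<lambda>\<sigma>. (support \<sigma> m, \<sigma> \<circ> inv (cycle_of_list (support \<sigma> m)))"])
    fix \<sigma> assume "\<sigma> \<in> {\<sigma>. \<sigma> permutes S}"
    then have \<sigma>: "\<sigma> permutes S" by simp
    then have ps: "permutation \<sigma>" using S by (auto simp: permutation_permutes)
    let ?us = "support \<sigma> m"
    let ?c = "cycle_of_list ?us"
    have bij: "bij ?c" using permutation_of_cycle permutation_bijective by blast
    have us: "distinct ?us" by (rule cycle_of_permutation[OF ps])
    have us': "?us \<noteq> []" "hd ?us = m"
      using least_power_of_permutation(2)[OF ps, of m]
      by (simp_all add: hd_map upt_conv_Cons)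
    have sub: "set ?us \<subseteq> S"
      using permutes_in_image[OF permutes_funpow[OF \<sigma>]] S(2) by auto
    have cp: "?c permutes set ?us" by (rule cycle_permutes)
    have "\<sigma> \<circ> inv ?c permutes S"
      by (rule permutes_compose[OF permutes_inv[OF permutes_subset[OF cp sub]] \<sigma>])
    then have \<tau>: "\<sigma> \<circ> inv ?c permutes S - set ?us"
    proof (rule permutes_superset)
      fix x assume "x \<in> S - (S - set ?us)"
      then have "x \<in> set ?us" by blast
      then have "inv ?c x \<in> set ?us" using permutes_in_image[OF permutes_inv[OF cp]] by blast
      then have "\<sigma> (inv ?c x) = ?c (inv ?c x)" using cycle_restrict[OF ps] by metis
      also have "\<dots> = x" using bij by (simp add: bij_is_surj surj_f_inv_f)
      finally show "(\<sigma> \<circ> inv ?c) x = x" by simp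
    qed
    show comp: "(case (?us, \<sigma> \<circ> inv ?c) of (us, \<tau>) \<Rightarrow> \<tau> \<circ> cycle_of_list us) = \<sigma>"
      using bij by (simp add: o_assoc[symmetric] bij_is_inj inv_o_cancel)
    show "(?us, \<sigma> \<circ> inv ?c) \<in> Sigma ?U ?P"
      using us us' sub \<tau> by blast
    have comp': "(\<sigma> \<circ> inv ?c) \<circ> ?c = \<sigma>" using comp by simp
    note f = moore_summand_comp_cycle(1)[where M = M, OF S us us' sub \<tau>, unfolded comp']
    show "(case (?us, \<sigma> \<circ> inv ?c) of (us, \<tau>) \<Rightarrow> ?t (S - set us) \<tau> * ?g us) = ?t S \<sigma>"
      using f by (simp only: prod.case)
  next
    fix p assume "p \<in> Sigma ?U ?P"
    then obtain us \<tau> where p: "p = (us, \<tau>)" and us: "distinct us" "us \<noteq> []" "hd us = m" "set us \<subseteq> S"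
      and \<tau>: "\<tau> permutes S - set us" by auto
    note f = moore_summand_comp_cycle(2,3)[OF S us \<tau>]
    have "bij (cycle_of_list us)" using permutation_of_cycle permutation_bijective by blast
    then have c: "cycle_of_list us \<circ> inv (cycle_of_list us) = id"
      by (metis bij_is_surj surj_iff)
    show "(support (case p of (us, \<tau>) \<Rightarrow> \<tau> \<circ> cycle_of_list us) m,
        (case p of (us, \<tau>) \<Rightarrow> \<tau> \<circ> cycle_of_list us) \<circ>
          inv (cycle_of_list (support (case p of (us, \<tau>) \<Rightarrow> \<tau> \<circ> cycle_of_list us) m))) = p"
      unfolding p prod.case by (simp only: f(1) o_assoc[symmetric] c o_id)
    show "(case p of (us, \<tau>) \<Rightarrow> \<tau> \<circ> cycle_of_list us) \<in> {\<sigma>. \<sigma> permutes S}"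
      using f(2) p by simp
  qed
  also have "\<dots> = (\<Sum>us\<in>?U. \<Sum>\<tau>\<in>?P us. ?t (S - set us) \<tau> * ?g us)"
    by (rule sum.Sigma[symmetric]) (use finU S in \<open>auto intro: finite_permutations\<close>)
  also have "\<dots> = (\<Sum>us\<in>?U. mdet_on (S - set us) M * ?g us)"
    by (simp only: mdet_on_def sum_distrib_right)
  also have "\<dots> = (\<Sum>T | T \<subseteq> S \<and> m \<in> T. \<Sum>us | us \<in> ?U \<and> set us = T. mdet_on (S - set us) M * ?g us)"
    by (rule sum.group[symmetric]) (use finU S in \<open>auto\<close>)
  also have "\<dots> = (\<Sum>T | T \<subseteq> S \<and> m \<in> T. mdet_on (S - T) M * cycle_sum M m T)"
    unfolding cycle_sum_def sum_distrib_left
    by (intro sum.cong refl) auto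
  finally show ?thesis .
qed


section \<open>Families of disjoint blocks\<close>

definition disjoint_families :: "'c set \<Rightarrow> ('c \<Rightarrow> nat set) \<Rightarrow> nat set \<Rightarrow> 'c set set" where
  "disjoint_families E V S =
     {F. F \<subseteq> E \<and> (\<forall>C\<in>F. \<forall>D\<in>F. C \<noteq> D \<longrightarrow> V C \<inter> V D = {}) \<and> \<Union> (V ` F) \<subseteq> S}"

definition family_sum ::
  "'c set \<Rightarrow> ('c \<Rightarrow> nat set) \<Rightarrow> 'b::ring_1 \<Rightarrow> ('r::comm_monoid_mult \<Rightarrow> 'b) \<Rightarrow> ('c \<Rightarrow> 'r) \<Rightarrow> nat set \<Rightarrow> 'b"
  where "family_sum E V x f w S =
    (\<Sum>F\<in>disjoint_families E V S. x ^ (card S - card (\<Union> (V ` F))) * f (\<Prod>C\<in>F. w C))"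

lemma finite_disjoint_families: "finite E \<Longrightarrow> finite (disjoint_families E V S)"
  by (rule finite_subset[of _ "Pow E"]) (auto simp: disjoint_families_def)

lemma family_sum_rec:
  fixes x :: "'b::ring_1" and f :: "'r::comm_monoid_mult \<Rightarrow> 'b"
  assumes E: "finite E" and S: "finite S" "m \<in> S"
    and f: "\<And>r s. f (r * s) = f r * f s" and x: "\<And>r. x * f r = f r * x"
  shows "family_sum E V x f w S = family_sum E V x f w (S - {m}) * x +
    (\<Sum>C | C \<in> E \<and> m \<in> V C \<and> V C \<subseteq> S. family_sum E V x f w (S - V C) * f (w C))"
proof -
  let ?F = "disjoint_families E V"
  let ?t = "\<lambda>S F. x ^ (card S - card (\<Union> (V ` F))) * f (\<Prod>C\<in>F. w C)"
  let ?D = "{C. C \<in> E \<and> m \<in> V C \<and> V C \<subseteq> S}"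
  let ?A = "{F \<in> ?F S. m \<notin> \<Union> (V ` F)}" and ?B = "{F \<in> ?F S. m \<in> \<Union> (V ` F)}"
  have fin: "finite (?F S)" for S by (rule finite_disjoint_families[OF E])
  have finF: "finite F" if "F \<in> ?F S" for F S
    using that E by (auto simp: disjoint_families_def intro: finite_subset)
  have A: "?A = ?F (S - {m})" by (auto simp: disjoint_families_def)
  have "(\<Sum>F\<in>?A. ?t S F) = (\<Sum>F\<in>?F (S - {m}). ?t (S - {m}) F * x)"
    unfolding A
  proof (rule sum.cong[OF refl])
    fix F assume "F \<in> ?F (S - {m})"
    then have "\<Union> (V ` F) \<subseteq> S - {m}" by (auto simp: disjoint_families_def)
    then have "card (\<Union> (V ` F)) \<le> card (S - {m})" using S by (intro card_mono) auto
    then have "card S - card (\<Union> (V ` F)) = Suc (card (S - {m}) - card (\<Union> (V ` F)))"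
      using S card_Suc_Diff1[OF S] by simp
    then show "?t S F = ?t (S - {m}) F * x"
      by (simp add: power_Suc2 mult.assoc x del: power_Suc)
  qed
  then have sA: "(\<Sum>F\<in>?A. ?t S F) = family_sum E V x f w (S - {m}) * x"
    by (simp add: family_sum_def sum_distrib_right)
  have B: "?B = (\<lambda>(C, F). insert C F) ` Sigma ?D (\<lambda>C. ?F (S - V C))"
  proof (intro subset_antisym subsetI)
    fix F assume F: "F \<in> ?B"
    then obtain C where C: "C \<in> F" "m \<in> V C" by auto
    have "C \<in> ?D" using F C by (auto simp: disjoint_families_def)
    moreover have "F - {C} \<in> ?F (S - V C)"
      using F C unfolding disjoint_families_def by blast
    ultimately have "(C, F - {C}) \<in> Sigma ?D (\<lambda>C. ?F (S - V C))" by blast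
    then have "(\<lambda>(C, F). insert C F) (C, F - {C}) \<in> (\<lambda>(C, F). insert C F) ` Sigma ?D (\<lambda>C. ?F (S - V C))"
      by (rule imageI)
    then show "F \<in> (\<lambda>(C, F). insert C F) ` Sigma ?D (\<lambda>C. ?F (S - V C))"
      using C by (simp add: insert_absorb)
  next
    fix F' assume "F' \<in> (\<lambda>(C, F). insert C F) ` Sigma ?D (\<lambda>C. ?F (S - V C))"
    then obtain C F where F': "F' = insert C F" and "C \<in> ?D" "F \<in> ?F (S - V C)" by auto
    then have C: "C \<in> E" "m \<in> V C" "V C \<subseteq> S" and F: "F \<subseteq> E" "\<Union> (V ` F) \<subseteq> S - V C"
      and dj: "\<And>C D. C \<in> F \<Longrightarrow> D \<in> F \<Longrightarrow> C \<noteq> D \<Longrightarrow> V C \<inter> V D = {}"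
      unfolding disjoint_families_def by simp_all
    have dj': "V C \<inter> V D = {}" "V D \<inter> V C = {}" if "D \<in> F" for D using F(2) that by blast+
    have "\<forall>C'\<in>F'. \<forall>D\<in>F'. C' \<noteq> D \<longrightarrow> V C' \<inter> V D = {}"
      unfolding F' using dj dj' by simp
    moreover have "\<Union> (V ` F') \<subseteq> S" "m \<in> \<Union> (V ` F')" "F' \<subseteq> E" using C F by (auto simp: F')
    ultimately show "F' \<in> ?B" unfolding disjoint_families_def by simp
  qed
  have notin: "C' \<notin> F" if "C \<in> ?D" "C' \<in> ?D" "F \<in> ?F (S - V C)" for C C' F
    using that unfolding disjoint_families_def by blast
  have inj: "inj_on (\<lambda>(C, F). insert C F) (Sigma ?D (\<lambda>C. ?F (S - V C)))"
  proof (rule inj_onI)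
    fix p q assume "p \<in> Sigma ?D (\<lambda>C. ?F (S - V C))" "q \<in> Sigma ?D (\<lambda>C. ?F (S - V C))"
      and eq: "(\<lambda>(C, F). insert C F) p = (\<lambda>(C, F). insert C F) q"
    then obtain C F C' F' where p: "p = (C, F)" "q = (C', F')"
      and a: "C \<in> ?D" "F \<in> ?F (S - V C)" "C' \<in> ?D" "F' \<in> ?F (S - V C')"
      by (elim SigmaE) simp
    have "C \<notin> F" "C \<notin> F'" "C' \<notin> F" "C' \<notin> F'"
      using notin[OF a(1) a(1) a(2)] notin[OF a(1) a(3) a(2)] notin[OF a(3) a(1) a(4)]
        notin[OF a(3) a(3) a(4)] by simp_all
    moreover have ins: "insert C F = insert C' F'" using eq p by simp
    ultimately have "C = C'" by blast
    with ins \<open>C \<notin> F\<close> \<open>C \<notin> F'\<close> show "p = q" unfolding p by (simp add: insert_ident)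
  qed
  have "(\<Sum>F\<in>?B. ?t S F) = (\<Sum>(C, F)\<in>Sigma ?D (\<lambda>C. ?F (S - V C)). ?t S (insert C F))"
    unfolding B by (subst sum.reindex[OF inj]) (simp add: case_prod_unfold)
  also have "\<dots> = (\<Sum>C\<in>?D. \<Sum>F\<in>?F (S - V C). ?t S (insert C F))"
    by (rule sum.Sigma[symmetric]) (use E fin in auto)
  also have "\<dots> = (\<Sum>C\<in>?D. family_sum E V x f w (S - V C) * f (w C))"
    unfolding family_sum_def sum_distrib_right
  proof (intro sum.cong refl)
    fix C F assume C: "C \<in> ?D" and F: "F \<in> ?F (S - V C)"
    have U: "\<Union> (V ` F) \<subseteq> S - V C" using F by (auto simp: disjoint_families_def)
    have fV: "finite (V C)" using C S by (auto intro: finite_subset)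
    have "card (\<Union> (V ` insert C F)) = card (V C) + card (\<Union> (V ` F))"
      using U S fV by (simp, subst card_Un_disjoint) (auto intro: finite_subset)
    moreover have "card (S - V C) = card S - card (V C)"
      using C fV by (intro card_Diff_subset) auto
    ultimately have "card S - card (\<Union> (V ` insert C F)) = card (S - V C) - card (\<Union> (V ` F))"
      by simp
    moreover have "(\<Prod>C\<in>insert C F. w C) = (\<Prod>C\<in>F. w C) * w C"
      using finF[OF F] notin[OF C C F] by (simp add: mult.commute)
    ultimately show "?t S (insert C F) = ?t (S - V C) F * f (w C)"
      by (simp only: f mult.assoc)
  qed
  finally have sB: "(\<Sum>F\<in>?B. ?t S F) = (\<Sum>C\<in>?D. family_sum E V x f w (S - V C) * f (w C))" .
  have "family_sum E V x f w S = (\<Sum>F\<in>?A \<union> ?B. ?t S F)"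
    unfolding family_sum_def by (rule sum.cong) auto
  also have "\<dots> = (\<Sum>F\<in>?A. ?t S F) + (\<Sum>F\<in>?B. ?t S F)"
    by (rule sum.union_disjoint) (use fin in auto)
  finally show ?thesis unfolding sA sB .
qed

lemma cycle_sum_singleton: "cycle_sum M m {m} = M m m"
proof -
  have "{us. distinct us \<and> us \<noteq> [] \<and> hd us = m \<and> set us = {m}} = {[m]}"
  proof (intro subset_antisym subsetI)
    fix us assume "us \<in> {us. distinct us \<and> us \<noteq> [] \<and> hd us = m \<and> set us = {m}}"
    then have us: "distinct us" "hd us = m" "set us = {m}" by simp_all
    have "length us = 1" using distinct_card[OF us(1)] us(3) by simp
    then show "us \<in> {[m]}" using us(2) by (auto simp: length_Suc_conv)
  qed simp
  then show ?thesis by (simp add: cycle_sum_def cyclic_prod_def)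
qed

theorem mdet_on_eq_family_sum:
  fixes x :: "'b::ring_1" and f :: "'r::comm_monoid_mult \<Rightarrow> 'b"
  assumes E: "finite E" "\<And>C. C \<in> E \<Longrightarrow> card (V C) \<ge> 2" and S: "finite S"
    and f: "f 1 = 1" "\<And>r s. f (r * s) = f r * f s" and x: "\<And>r. x * f r = f r * x"
    and diag: "\<And>m. m \<in> S \<Longrightarrow> M m m = x"
    and cyc: "\<And>m T. m \<in> T \<Longrightarrow> T \<subseteq> S \<Longrightarrow> card T \<ge> 2 \<Longrightarrow> cycle_sum M m T = (\<Sum>C | C \<in> E \<and> V C = T. f (w C))"
  shows "mdet_on S M = family_sum E V x f w S"
  using S diag cyc
proof (induction "card S" arbitrary: S rule: less_induct)
  case less
  note S = \<open>finite S\<close>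
  show ?case
  proof (cases "S = {}")
    case True
    have "disjoint_families E V {} = {{}}"
      using E(2) by (fastforce simp: disjoint_families_def)
    then show ?thesis using True f(1) by (simp add: mdet_on_empty family_sum_def)
  next
    case False
    define m where "m = Min S"
    have m: "m \<in> S" "\<And>a. a \<in> S \<Longrightarrow> m \<le> a" using False S by (auto simp: m_def)
    let ?T = "{T. T \<subseteq> S \<and> m \<in> T}"
    let ?Q = "family_sum E V x f w"
    let ?D = "{C. C \<in> E \<and> m \<in> V C \<and> V C \<subseteq> S}"
    have IH: "mdet_on (S - T) M = ?Q (S - T)" if "T \<in> ?T" for T
    proof (rule less.hyps)
      show "card (S - T) < card S" using that S m by (intro psubset_card_mono) auto
      show "finite (S - T)" using S by simp
      show "M k k = x" if "k \<in> S - T" for k using that less.prems(2) by blast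
      show "cycle_sum M k U = (\<Sum>C | C \<in> E \<and> V C = U. f (w C))"
        if "k \<in> U" "U \<subseteq> S - T" "card U \<ge> 2" for k U
        using that less.prems(3) by blast
    qed
    have fin: "finite ?T" using S by simp
    have "mdet_on S M = (\<Sum>T\<in>?T. ?Q (S - T) * cycle_sum M m T)"
      using mdet_on_rec[OF S m, of M] by (simp only: IH cong: sum.cong)
    also have "\<dots> = ?Q (S - {m}) * cycle_sum M m {m} + (\<Sum>T\<in>?T - {{m}}. ?Q (S - T) * cycle_sum M m T)"
      using m by (intro sum.remove[OF fin]) auto
    also have "(\<Sum>T\<in>?T - {{m}}. ?Q (S - T) * cycle_sum M m T)
       = (\<Sum>T\<in>?T - {{m}}. \<Sum>C | C \<in> ?D \<and> V C = T. ?Q (S - V C) * f (w C))"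
    proof (rule sum.cong[OF refl])
      fix T assume T: "T \<in> ?T - {{m}}"
      then have "finite T" using S by (auto intro: finite_subset)
      have "card T \<ge> 2"
      proof (rule ccontr)
        assume "\<not> 2 \<le> card T"
        moreover have "card T > 0" using T \<open>finite T\<close> by (auto simp: card_gt_0_iff)
        ultimately have "card T = 1" by linarith
        then show False using T by (auto simp: card_1_singleton_iff)
      qed
      then have "cycle_sum M m T = (\<Sum>C | C \<in> E \<and> V C = T. f (w C))"
        using T less.prems(3) by blast
      moreover have "{C. C \<in> ?D \<and> V C = T} = {C. C \<in> E \<and> V C = T}" using T by auto
      ultimately show "?Q (S - T) * cycle_sum M m T = (\<Sum>C | C \<in> ?D \<and> V C = T. ?Q (S - V C) * f (w C))"
        by (simp add: sum_distrib_left)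
    qed
    also have "\<dots> = (\<Sum>C\<in>?D. ?Q (S - V C) * f (w C))"
      by (rule sum.group) (use E S in \<open>fastforce+\<close>)
    also have "?Q (S - {m}) * cycle_sum M m {m} = ?Q (S - {m}) * x"
      using less.prems(2) m by (simp add: cycle_sum_singleton)
    also have "?Q (S - {m}) * x + (\<Sum>C\<in>?D. ?Q (S - V C) * f (w C)) = ?Q S"
      by (rule family_sum_rec[OF E(1) S m(1) f(2) x, symmetric])
    finally show ?thesis .
  qed
qed


section \<open>Dual scalars and traversals of cycles\<close>

lemma sconj_mult_self: "sconj x * x = (norm x)\<^sup>2 *\<^sub>R (1 :: 'a::gain_scalar)"
proof -
  have "sconj x = (2 * sre x) *\<^sub>R 1 - x" by (metis add_sconj add_diff_cancel_left')
  then have "sconj x * x = x * sconj x" by (simp only: left_diff_distrib right_diff_distrib) simp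
  then show ?thesis by (simp add: mult_sconj)
qed

lemma sconj_one: "sconj 1 = (1 :: 'a::gain_scalar)"
  using mult_sconj[of "1 :: 'a"] by simp

lemma sre_eqI: "x + sconj x = (2 * r) *\<^sub>R 1 \<Longrightarrow> sre (x :: 'a::gain_scalar) = r"
  by (simp add: add_sconj)

lemma sre_add: "sre (x + y :: 'a::gain_scalar) = sre x + sre y"
proof (rule sre_eqI)
  have "x + y + sconj (x + y) = (x + sconj x) + (y + sconj y)" by (simp add: sconj_add)
  then show "x + y + sconj (x + y) = (2 * (sre x + sre y)) *\<^sub>R 1"
    by (simp add: add_sconj algebra_simps)
qed

lemma sre_mult_commute: "sre (x * y) = sre (y * x :: 'a::gain_scalar)"
proof (cases "x = 0")
  case False
  have "sconj x * (x * y + sconj (x * y)) * x = sconj x * ((2 * sre (x * y)) *\<^sub>R 1) * x"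
    by (simp only: add_sconj)
  also have "\<dots> = (2 * sre (x * y)) *\<^sub>R (sconj x * x)" by simp
  also have "sconj x * (x * y + sconj (x * y)) * x
      = (sconj x * x) * (y * x) + sconj x * sconj y * (sconj x * x)"
    by (simp add: sconj_mult algebra_simps)
  also have "\<dots> = (norm x)\<^sup>2 *\<^sub>R (y * x + sconj (y * x))"
    by (simp add: sconj_mult_self sconj_mult scaleR_right_distrib)
  finally have "(norm x)\<^sup>2 *\<^sub>R (y * x + sconj (y * x)) = (norm x)\<^sup>2 *\<^sub>R ((2 * sre (x * y)) *\<^sub>R 1)"
    by (simp add: sconj_mult_self mult.commute)
  then have "y * x + sconj (y * x) = (2 * sre (x * y)) *\<^sub>R 1"
    using False by (subst (asm) scaleR_cancel_left) simp
  then show ?thesis by (rule sre_eqI[symmetric])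
qed simp

lemma dual_sel [simp]:
  "std 0 = 0" "dul 0 = 0" "std 1 = 1" "dul 1 = 0"
  "std (a + b) = std a + std b" "dul (a + b) = dul a + dul b"
  "std (- a) = - std a" "dul (- a) = - dul a"
  "std (a * b) = std a * std b" "dul (a * b) = std a * dul b + dul a * std b"
  by (simp_all add: zero_dual_def one_dual_def plus_dual_def uminus_dual_def times_dual_def)

lemma dual_re_mult_commute: "dual_re (a * b) = dual_re (b * a)"
  unfolding dual_re_def dual.inject dual_sel sre_add
  by (simp add: sre_mult_commute[of "std a"] sre_mult_commute[of "dul a"])

definition dual_conj :: "'a::gain_scalar dual \<Rightarrow> 'a dual" where
  "dual_conj a = Dual (sconj (std a)) (sconj (dul a))"

lemma sconj_zero: "sconj 0 = (0 :: 'a::gain_scalar)"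
  using sconj_add[of 0 "0 :: 'a"] by simp

lemma dual_conj_one: "dual_conj 1 = 1"
  by (simp add: dual_conj_def sconj_one sconj_zero dual_eq_iff)

lemma dual_conj_mult: "dual_conj (a * b) = dual_conj b * dual_conj a"
  by (simp add: dual_conj_def sconj_mult sconj_add dual_eq_iff add.commute)

lemma dual_conj_prod_list: "dual_conj (prod_list xs) = prod_list (rev (map dual_conj xs))"
  by (induct xs) (simp_all add: dual_conj_one dual_conj_mult)

lemma of_real_dual_one: "of_real_dual 1 = 1"
  by (simp add: of_real_dual_def dual_eq_iff)

lemma of_real_dual_add: "of_real_dual (a + b) = of_real_dual a + of_real_dual b"
  by (simp add: of_real_dual_def dual_eq_iff)

lemma of_real_dual_minus: "of_real_dual (- a) = - of_real_dual a"
  by (simp add: of_real_dual_def dual_eq_iff)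

lemma of_real_dual_mult: "of_real_dual (a * b) = of_real_dual a * of_real_dual b"
  by (simp add: of_real_dual_def dual_eq_iff)

lemma of_real_dual_sum: "of_real_dual (sum g A) = (\<Sum>x\<in>A. of_real_dual (g x))"
proof -
  have "of_real_dual (0::real dual) = (0::'a dual)" by (simp add: of_real_dual_def dual_eq_iff)
  then show ?thesis
    by (induct A rule: infinite_finite_induct) (simp_all add: of_real_dual_add)
qed

lemma dual_conj_add_self: "a + dual_conj a = of_real_dual (2 * dual_re a)"
proof -
  have *: "of_real_dual (2 * dual_re a) = of_real_dual (dual_re a) + of_real_dual (dual_re a)"
    by (simp only: mult_2 of_real_dual_add)
  have "x + sconj x = of_real (sre x) + of_real (sre x)" for x :: 'a
    by (simp add: add_sconj of_real_def scaleR_left_distrib[symmetric])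
  then show ?thesis
    unfolding * by (simp add: dual_conj_def of_real_dual_def dual_re_def dual_eq_iff)
qed

lemma unit_dual_inverse_eq_conj:
  assumes "unit_dual p" "q * p = 1"
  shows "q = dual_conj p"
proof -
  have "p * dual_conj p = 1"
    using assms(1) by (simp add: unit_dual_def dual_conj_def dual_eq_iff mult_sconj)
  then have "q * p * dual_conj p = q" by (simp add: mult.assoc)
  then show ?thesis using assms(2) by simp
qed

lemma zip_rotate1:
  "length xs = length ys \<Longrightarrow> zip (rotate1 xs) (rotate1 ys) = rotate1 (zip xs ys)"
  by (cases xs; cases ys) simp_all

lemma rotate1_rev_rotate1: "rotate1 (rev (rotate1 xs)) = rev xs"
  by (cases xs) simp_all

lemma cyclic_prod_zip: "cyclic_prod m us = prod_list (map (\<lambda>(a, b). m a b) (zip us (rotate1 us)))"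
  unfolding cyclic_prod_def
  by (rule arg_cong[of _ _ prod_list], rule nth_equalityI) (simp_all add: nth_rotate1)

definition cyclic_edges :: "'v list \<Rightarrow> 'v set set" where
  "cyclic_edges us = (\<lambda>(a, b). {a, b}) ` set (zip us (rotate1 us))"

lemma cyclic_edges_nth:
  "cyclic_edges us = {{us ! k, us ! (Suc k mod length us)} | k. k < length us}"
  by (force simp: cyclic_edges_def set_zip nth_rotate1)

lemma traversal_iff:
  "traversal us C \<longleftrightarrow> distinct us \<and> length us \<ge> 3 \<and> C = (set us, cyclic_edges us)"
  by (simp add: traversal_def cyclic_edges_nth)

lemma traversal_rotate1: "traversal us C \<Longrightarrow> traversal (rotate1 us) C"
  by (simp add: traversal_iff cyclic_edges_def zip_rotate1)

lemma zip_reflect: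
  "zip (rev (rotate1 us)) (rotate1 (rev (rotate1 us))) = rev (map prod.swap (zip us (rotate1 us)))"
  by (simp add: rotate1_rev_rotate1 zip_rev rev_map[symmetric] zip_commute[of "rotate1 us" us] prod.swap_def case_prod_unfold)

lemma traversal_reflect:
  assumes "traversal us C" shows "traversal (rev (rotate1 us)) C"
proof -
  have "cyclic_edges (rev (rotate1 us)) = cyclic_edges us"
    unfolding cyclic_edges_def zip_reflect
    by (simp add: image_image case_prod_unfold insert_commute)
  then show ?thesis using assms by (simp add: traversal_iff)
qed

lemma cyclic_prod_reflect:
  assumes "\<And>a b. {a, b} \<in> cyclic_edges us \<Longrightarrow> \<phi> b a = dual_conj (\<phi> a b)"
  shows "cyclic_prod \<phi> (rev (rotate1 us)) = dual_conj (cyclic_prod \<phi> us)"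
proof -
  have *: "map (\<lambda>(a, b). \<phi> a b) (map prod.swap (zip us (rotate1 us)))
      = map dual_conj (map (\<lambda>(a, b). \<phi> a b) (zip us (rotate1 us)))"
    using assms by (force simp: cyclic_edges_def)
  show ?thesis
    unfolding cyclic_prod_zip zip_reflect dual_conj_prod_list by (simp only: rev_map[symmetric] *)
qed

lemma dual_re_cyclic_prod_rotate1:
  fixes \<phi> :: "'v \<Rightarrow> 'v \<Rightarrow> 'a::gain_scalar dual"
  shows "dual_re (cyclic_prod \<phi> (rotate1 us)) = dual_re (cyclic_prod \<phi> us)"
proof -
  have "dual_re (prod_list (rotate1 ys)) = dual_re (prod_list ys)" for ys :: "'a dual list"
    by (cases ys) (simp_all add: dual_re_mult_commute)
  then show ?thesis by (simp add: cyclic_prod_zip zip_rotate1 rotate1_map[symmetric])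
qed

lemma traversal_rotate:
  "traversal us C \<Longrightarrow> traversal (rotate k us) C"
  "dual_re (cyclic_prod \<phi> (rotate k us)) = dual_re (cyclic_prod \<phi> us)"
  by (induct k) (simp_all add: traversal_rotate1 dual_re_cyclic_prod_rotate1)

lemma traversal_rotate_hd:
  assumes "traversal us C" "m \<in> verts C"
  obtains k where "hd (rotate k us) = m"
proof -
  obtain k where "k < length us" "us ! k = m"
    using assms by (auto simp: traversal_iff in_set_conv_nth)
  then have "hd (rotate k us) = m" by (subst hd_rotate_conv_nth) auto
  then show ?thesis by (rule that)
qed

lemma cyclic_edges_neighbour:
  assumes "distinct us" "i < length us" "{us ! i, y} \<in> cyclic_edges us"
  obtains "y = us ! (Suc i mod length us)" | k where "k < length us" "Suc k mod length us = i" "y = us ! k"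
proof -
  obtain k where k: "k < length us" "{us ! i, y} = {us ! k, us ! (Suc k mod length us)}"
    using assms(3) by (auto simp: cyclic_edges_nth)
  have l: "Suc k mod length us < length us" using k by (intro mod_less_divisor) linarith
  from k(2) consider "us ! i = us ! k" "y = us ! (Suc k mod length us)"
    | "us ! i = us ! (Suc k mod length us)" "y = us ! k"
    by (auto simp: doubleton_eq_iff)
  then show ?thesis
    using that assms k l by cases (auto simp: nth_eq_iff_index_eq)
qed

lemma cyclic_edges_determine_list:
  assumes us: "distinct us" "length us \<ge> 3" and vs: "distinct vs" "length vs = length us"
    and sub: "cyclic_edges vs \<subseteq> cyclic_edges us" and "us ! 0 = vs ! 0" "us ! 1 = vs ! 1"
  shows "vs = us"
proof -
  let ?l = "length us"
  have "Suc k < ?l \<Longrightarrow> vs ! k = us ! k \<and> vs ! Suc k = us ! Suc k" for k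
  proof (induct k)
    case 0 then show ?case using assms by simp
  next
    case (Suc k)
    then have IH: "vs ! k = us ! k" "vs ! Suc k = us ! Suc k" by simp_all
    have "{us ! Suc k, vs ! Suc (Suc k)} \<in> cyclic_edges vs"
      unfolding cyclic_edges_nth using Suc(2) vs IH
      by (auto intro!: exI[of _ "Suc k"])
    then have "{us ! Suc k, vs ! Suc (Suc k)} \<in> cyclic_edges us" using sub by blast
    moreover have "Suc k < ?l" using Suc(2) by simp
    ultimately show ?case
    proof (rule_tac cyclic_edges_neighbour[OF us(1), of "Suc k"])
      assume "vs ! Suc (Suc k) = us ! (Suc (Suc k) mod ?l)"
      then show ?thesis using Suc(2) IH by simp
    next
      fix j assume j: "j < ?l" "Suc j mod ?l = Suc k" "vs ! Suc (Suc k) = us ! j"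
      have "j = k"
        using j(1,2) by (cases "Suc j = ?l") auto
      then have "vs ! Suc (Suc k) = vs ! k" using j IH by simp
      then show ?thesis using vs Suc(2) by (simp add: nth_eq_iff_index_eq)
    qed
  qed
  note * = this
  show ?thesis
  proof (rule nth_equalityI)
    fix k assume k: "k < length vs"
    then show "vs ! k = us ! k"
      using *[of k] *[of "k - 1"] us vs by (cases "Suc k < ?l") auto
  qed (use vs in simp)
qed

lemma traversals_from:
  assumes "traversal us C" "hd us = m"
  shows "{vs. traversal vs C \<and> hd vs = m} = {us, rev (rotate1 us)}" "us \<noteq> rev (rotate1 us)"
proof -
  let ?l = "length us" and ?r = "rev (rotate1 us)"
  have us: "distinct us" "?l \<ge> 3" "C = (set us, cyclic_edges us)" using assms by (auto simp: traversal_iff)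
  have r: "traversal ?r C" by (rule traversal_reflect[OF assms(1)])
  obtain t where t: "us = m # t" using us(2) assms(2) by (cases us) auto
  have r_eq: "?r = m # rev t" by (simp add: t)
  have r1: "?r ! 1 = us ! (?l - 1)" using us(2) by (auto simp: t rev_nth nth_Cons')
  show "us \<noteq> ?r"
  proof
    assume "us = ?r"
    then have "us ! 1 = us ! (?l - 1)" using r1 by simp
    then have "1 = ?l - 1" using us by (subst (asm) nth_eq_iff_index_eq) auto
    then show False using us by simp
  qed
  have "vs = us \<or> vs = ?r" if "traversal vs C" "hd vs = m" for vs
  proof -
    have vs: "distinct vs" "length vs \<ge> 3" "set vs = set us" "cyclic_edges vs = cyclic_edges us"
      using that us by (auto simp: traversal_iff)
    have len: "length vs = ?l" using vs us by (metis distinct_card)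
    have "vs ! 0 = m" using that(2) vs(2) by (cases vs) auto
    then have 0: "us ! 0 = m" "vs ! 0 = m" "?r ! 0 = m" by (simp_all add: r_eq t)
    have "{us ! 0, vs ! 1} \<in> cyclic_edges vs"
      unfolding cyclic_edges_nth using vs(2) 0 by (auto intro!: exI[of _ 0])
    then have e: "{us ! 0, vs ! 1} \<in> cyclic_edges us" using vs by simp
    have "0 < ?l" using us(2) by linarith
    from us(1) this e show ?thesis
    proof (rule cyclic_edges_neighbour)
      assume "vs ! 1 = us ! (Suc 0 mod ?l)"
      then have "us ! 1 = vs ! 1" using us by simp
      then show ?thesis using cyclic_edges_determine_list[of us vs] us vs len 0 by simp
    next
      fix k assume k: "k < ?l" "Suc k mod ?l = 0" "vs ! 1 = us ! k"
      have "Suc k = ?l" using k(1,2) by (cases "Suc k = ?l") auto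
      then have k: "k = ?l - 1" by simp
      then have "?r ! 1 = vs ! 1" using \<open>vs ! 1 = us ! k\<close> r1 by simp
      moreover have "cyclic_edges ?r = cyclic_edges us" using r us by (simp add: traversal_iff)
      ultimately have "vs = ?r"
        using cyclic_edges_determine_list[of ?r vs] us vs len 0 by simp
      then show ?thesis ..
    qed
  qed
  then show "{vs. traversal vs C \<and> hd vs = m} = {us, ?r}"
    using assms r r_eq by auto
qed

lemma sum_traversals_from:
  fixes \<phi> :: "'v \<Rightarrow> 'v \<Rightarrow> 'a::gain_scalar dual"
  assumes C: "is_cycle C" "m \<in> verts C"
    and \<phi>: "\<And>a b. {a, b} \<in> edges C \<Longrightarrow> \<phi> b a = dual_conj (\<phi> a b)"
  shows "(\<Sum>us | traversal us C \<and> hd us = m. cyclic_prod \<phi> us) = of_real_dual (2 * cycle_re \<phi> C)"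
proof -
  define ws where "ws = (SOME us. traversal us C)"
  have ws: "traversal ws C"
    unfolding ws_def by (rule someI_ex) (use C in \<open>simp add: is_cycle_def\<close>)
  obtain k where k: "hd (rotate k ws) = m" using traversal_rotate_hd[OF ws C(2)] .
  define us where "us = rotate k ws"
  have us: "traversal us C" "hd us = m" using k traversal_rotate(1)[OF ws] by (simp_all add: us_def)
  have "(\<Sum>us | traversal us C \<and> hd us = m. cyclic_prod \<phi> us) = cyclic_prod \<phi> us + cyclic_prod \<phi> (rev (rotate1 us))"
    unfolding traversals_from(1)[OF us] using traversals_from(2)[OF us] by simp
  also have "cyclic_prod \<phi> (rev (rotate1 us)) = dual_conj (cyclic_prod \<phi> us)"
    using us(1) \<phi> by (intro cyclic_prod_reflect) (auto simp: traversal_iff)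
  also have "cyclic_prod \<phi> us + dual_conj (cyclic_prod \<phi> us) = of_real_dual (2 * dual_re (cyclic_prod \<phi> us))"
    by (rule dual_conj_add_self)
  also have "dual_re (cyclic_prod \<phi> us) = cycle_re \<phi> C"
    by (simp add: us_def traversal_rotate(2) cycle_re_def ws_def)
  finally show ?thesis .
qed


section \<open>Elementary and basic graphs\<close>

lemma is_cycle_card: "is_cycle C \<Longrightarrow> card (verts C) \<ge> 3"
  by (auto simp: is_cycle_def traversal_iff distinct_card)

lemma is_K2_card: "is_K2 C \<Longrightarrow> card (verts C) = 2"
  by (auto simp: is_K2_def)

lemma elementary_graph_card: "elementary_graph C \<Longrightarrow> card (verts C) \<ge> 2"
  using is_cycle_card[of C] is_K2_card[of C] by (auto simp: elementary_graph_def)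

lemma simple_graph_cyclic_edges:
  assumes "distinct us" "length us \<ge> 2"
  shows "simple_graph (set us, cyclic_edges us)"
proof -
  have "us ! k \<noteq> us ! (Suc k mod length us)" if "k < length us" for k
  proof -
    have "Suc k mod length us < length us" using assms by (intro mod_less_divisor) linarith
    moreover have "k \<noteq> Suc k mod length us"
      using that assms(2) by (cases "Suc k = length us") auto
    ultimately show ?thesis using that assms by (simp add: nth_eq_iff_index_eq)
  qed
  moreover have "us ! (Suc k mod length us) \<in> set us" for k
    using assms by (intro nth_mem mod_less_divisor) linarith
  ultimately show ?thesis
    by (auto simp: simple_graph_def cyclic_edges_nth)
qed

lemma simple_graph_elementary: "elementary_graph C \<Longrightarrow> simple_graph C"
  unfolding elementary_graph_def
proof (elim disjE)
  assume "is_cycle C"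
  then obtain us where "distinct us" "length us \<ge> 3" "C = (set us, cyclic_edges us)"
    by (auto simp: is_cycle_def traversal_iff)
  then show ?thesis using simple_graph_cyclic_edges[of us] by simp
qed (auto simp: is_K2_def simple_graph_def)

lemma elementary_graph_connected:
  assumes "elementary_graph C" "v \<in> verts C" "w \<in> verts C"
  shows "(v, w) \<in> {(x, y). {x, y} \<in> edges C}\<^sup>*"
proof (cases "is_K2 C")
  case True
  then show ?thesis using assms(2,3) by (auto simp: is_K2_def insert_commute)
next
  case False
  then obtain us where us: "traversal us C" using assms(1) by (auto simp: elementary_graph_def is_cycle_def)
  let ?R = "{(x, y). {x, y} \<in> edges C}\<^sup>*"
  have "sym ?R" by (rule sym_rtrancl) (simp add: sym_def insert_commute)
  have reach: "k < length us \<Longrightarrow> (us ! 0, us ! k) \<in> ?R" for k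
  proof (induct k)
    case (Suc k)
    have "{us ! k, us ! Suc k} \<in> edges C"
      using us Suc(2) by (auto simp: traversal_iff cyclic_edges_nth intro!: exI[of _ k])
    then show ?case using Suc by (auto intro: rtrancl.rtrancl_into_rtrancl)
  qed simp
  obtain i j where "i < length us" "us ! i = v" "j < length us" "us ! j = w"
    using us assms(2,3) by (auto simp: traversal_iff in_set_conv_nth)
  then have "(us ! 0, v) \<in> ?R" "(us ! 0, w) \<in> ?R" using reach by auto
  then show ?thesis using \<open>sym ?R\<close> by (meson rtrancl_trans symE)
qed

definition graph_union :: "'v graph set \<Rightarrow> 'v graph" where
  "graph_union F = (\<Union>C\<in>F. verts C, \<Union>C\<in>F. edges C)"

lemma component_of_graph_union:
  assumes el: "\<And>C. C \<in> F \<Longrightarrow> elementary_graph C"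
    and dj: "\<And>C D. C \<in> F \<Longrightarrow> D \<in> F \<Longrightarrow> C \<noteq> D \<Longrightarrow> verts C \<inter> verts D = {}"
    and C: "C \<in> F" "v \<in> verts C"
  shows "component_of (graph_union F) v = C"
proof -
  let ?R = "{(x, y). {x, y} \<in> edges (graph_union F)}"
  have sub: "e \<subseteq> verts D" "e \<noteq> {}" if "D \<in> F" "e \<in> edges D" for D e
    using simple_graph_elementary[OF el[OF that(1)]] that(2) by (auto simp: simple_graph_def)
  have "w \<in> verts C" if "(v, w) \<in> ?R\<^sup>*" for w
    using that
  proof (induct rule: rtrancl_induct)
    case (step y z)
    then obtain D where D: "D \<in> F" "{y, z} \<in> edges D" by (auto simp: graph_union_def)
    then have "y \<in> verts D" "z \<in> verts D" using sub(1)[OF D] by auto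
    then show ?case using dj[OF C(1) D(1)] step(3) by blast
  qed (rule C)
  moreover have "(v, w) \<in> ?R\<^sup>*" if "w \<in> verts C" for w
    using elementary_graph_connected[OF el[OF C(1)] C(2) that]
    by (rule rtrancl_mono[THEN subsetD, rotated]) (use C in \<open>auto simp: graph_union_def\<close>)
  ultimately have W: "{w. (v, w) \<in> ?R\<^sup>*} = verts C" by blast
  have "{e \<in> edges (graph_union F). e \<subseteq> verts C} = edges C"
  proof (intro subset_antisym subsetI)
    fix e assume e: "e \<in> {e \<in> edges (graph_union F). e \<subseteq> verts C}"
    then obtain D where D: "D \<in> F" "e \<in> edges D" by (auto simp: graph_union_def)
    then have "D = C" using sub[OF D] dj[OF D(1) C(1)] e by blast
    then show "e \<in> edges C" using D by simp
  next
    fix e assume "e \<in> edges C"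
    then show "e \<in> {e \<in> edges (graph_union F). e \<subseteq> verts C}"
      using C sub by (auto simp: graph_union_def)
  qed
  then show ?thesis unfolding component_of_def Let_def W by simp
qed

lemma components_graph_union:
  assumes el: "\<And>C. C \<in> F \<Longrightarrow> elementary_graph C"
    and dj: "\<And>C D. C \<in> F \<Longrightarrow> D \<in> F \<Longrightarrow> C \<noteq> D \<Longrightarrow> verts C \<inter> verts D = {}"
  shows "components (graph_union F) = F"
proof -
  have ne: "verts C \<noteq> {}" if "C \<in> F" for C
    using elementary_graph_card[OF el[OF that]] by auto
  show ?thesis
    unfolding components_def
  proof (intro subset_antisym subsetI)
    fix C assume "C \<in> component_of (graph_union F) ` verts (graph_union F)"
    then obtain v D where D: "D \<in> F" "v \<in> verts D" "C = component_of (graph_union F) v"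
      by (auto simp: graph_union_def)
    then show "C \<in> F" using component_of_graph_union[OF el dj D(1,2)] by simp
  next
    fix C assume C: "C \<in> F"
    then obtain v where v: "v \<in> verts C" using ne by blast
    then have "component_of (graph_union F) v = C" using component_of_graph_union[OF el dj C v] by simp
    moreover have "v \<in> verts (graph_union F)" using C v by (auto simp: graph_union_def)
    ultimately show "C \<in> component_of (graph_union F) ` verts (graph_union F)" by blast
  qed
qed

definition elementary_subgraphs :: "'v graph \<Rightarrow> 'v graph set" where
  "elementary_subgraphs G = {C. subgraph C G \<and> elementary_graph C}"

lemma finite_subgraphs:
  assumes "simple_graph G" shows "finite {H. subgraph H G}"
proof -
  have "finite (edges G)"
    using assms by (intro finite_subset[of "edges G" "Pow (verts G)"]) (auto simp: simple_graph_def)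
  then have "finite (Pow (verts G) \<times> Pow (edges G))" using assms by (simp add: simple_graph_def)
  then show ?thesis by (rule rev_finite_subset) (auto simp: subgraph_def)
qed

lemma bij_betw_graph_union:
  fixes G :: "nat graph"
  assumes "simple_graph G"
  shows "bij_betw graph_union (disjoint_families (elementary_subgraphs G) verts (verts G))
    {B. subgraph B G \<and> basic_graph B}"
proof (rule bij_betw_byWitness[where f' = components])
  let ?F = "disjoint_families (elementary_subgraphs G) verts (verts G)"
  have el: "elementary_graph C" "subgraph C G" if "F \<in> ?F" "C \<in> F" for F C
    using that by (auto simp: disjoint_families_def elementary_subgraphs_def)
  have dj: "verts C \<inter> verts D = {}" if "F \<in> ?F" "C \<in> F" "D \<in> F" "C \<noteq> D" for F C D
    using that by (auto simp: disjoint_families_def)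
  show comp: "\<forall>F\<in>?F. components (graph_union F) = F"
  proof
    fix F assume F: "F \<in> ?F"
    show "components (graph_union F) = F"
      by (rule components_graph_union) (use el[OF F] dj[OF F] in auto)
  qed
  have fin: "finite F" if "F \<in> ?F" for F
    by (rule finite_subset[OF _ finite_subgraphs[OF assms]]) (use el(2)[OF that] in blast)
  show "graph_union ` ?F \<subseteq> {B. subgraph B G \<and> basic_graph B}"
  proof
    fix B assume "B \<in> graph_union ` ?F"
    then obtain F where F: "F \<in> ?F" and B: "B = graph_union F" by blast
    have 1: "finite (verts C)" "\<And>e. e \<in> edges C \<Longrightarrow> e \<subseteq> verts C \<and> card e = 2"
      "verts C \<subseteq> verts G" "edges C \<subseteq> edges G" if "C \<in> F" for C
      using el(2)[OF F that] by (auto simp: subgraph_def simple_graph_def)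
    have "simple_graph (graph_union F)"
      unfolding simple_graph_def graph_union_def fst_conv snd_conv
      using fin[OF F] 1(1,2) by blast
    then have "subgraph (graph_union F) G"
      unfolding subgraph_def graph_union_def fst_conv snd_conv using 1(3,4) by blast
    moreover have "basic_graph (graph_union F)"
      unfolding basic_graph_def using el[OF F] dj[OF F]
      by (intro exI[of _ F] conjI ballI impI) (simp_all add: graph_union_def)
    ultimately show "B \<in> {B. subgraph B G \<and> basic_graph B}" by (simp add: B)
  qed
  have ex: "\<exists>F\<in>?F. B = graph_union F" if B: "subgraph B G" "basic_graph B" for B
  proof -
    obtain F where F: "\<And>C. C \<in> F \<Longrightarrow> elementary_graph C"
      "\<forall>C\<in>F. \<forall>D\<in>F. C \<noteq> D \<longrightarrow> verts C \<inter> verts D = {}" and B': "B = graph_union F"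
      using B(2) by (auto simp: basic_graph_def graph_union_def)
    have "subgraph C G" if "C \<in> F" for C
      using simple_graph_elementary[OF F(1)[OF that]] B(1) that
      by (auto simp: subgraph_def B' graph_union_def)
    moreover have "\<Union> (verts ` F) \<subseteq> verts G" using B(1) by (simp add: subgraph_def B' graph_union_def)
    ultimately have "F \<in> ?F"
      using F by (auto simp: disjoint_families_def elementary_subgraphs_def)
    then show ?thesis using B' by blast
  qed
  show "\<forall>B\<in>{B. subgraph B G \<and> basic_graph B}. graph_union (components B) = B"
    using ex comp by (metis mem_Collect_eq)
  show "components ` {B. subgraph B G \<and> basic_graph B} \<subseteq> ?F"
  proof
    fix F assume "F \<in> components ` {B. subgraph B G \<and> basic_graph B}"
    then obtain B where "subgraph B G" "basic_graph B" "F = components B" by blast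
    then show "F \<in> ?F" using ex[of B] comp by metis
  qed
qed

lemma cyclic_prod_gain_adjacency:
  fixes \<phi> :: "'v \<Rightarrow> 'v \<Rightarrow> 'a::gain_scalar dual"
  shows "cyclic_prod (gain_adjacency G \<phi>) us = (if cyclic_edges us \<subseteq> edges G then cyclic_prod \<phi> us else 0)"
proof (cases "cyclic_edges us \<subseteq> edges G")
  case True
  then have "map (\<lambda>(a, b). gain_adjacency G \<phi> a b) (zip us (rotate1 us)) = map (\<lambda>(a, b). \<phi> a b) (zip us (rotate1 us))"
    by (auto simp: cyclic_edges_def gain_adjacency_def)
  then show ?thesis using True by (simp only: cyclic_prod_zip if_True)
next
  case False
  have z: "0 \<in> set xs \<Longrightarrow> prod_list xs = 0" for xs :: "'a dual list"
    by (induct xs) auto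
  obtain a b where "(a, b) \<in> set (zip us (rotate1 us))" "{a, b} \<notin> edges G"
    using False by (auto simp: cyclic_edges_def)
  then have "0 \<in> set (map (\<lambda>(a, b). gain_adjacency G \<phi> a b) (zip us (rotate1 us)))"
    by (force simp: gain_adjacency_def)
  then show ?thesis using False z by (simp only: cyclic_prod_zip if_False)
qed

definition elementary_re :: "('v \<Rightarrow> 'v \<Rightarrow> 'a::gain_scalar dual) \<Rightarrow> 'v graph \<Rightarrow> real dual" where
  "elementary_re \<phi> C = (if is_cycle C then 2 * cycle_re \<phi> C else 1)"

lemma sum_cyclic_prod_gain_adjacency:
  fixes \<phi> :: "nat \<Rightarrow> nat \<Rightarrow> 'a::gain_scalar dual"
  assumes G: "dual_unit_gain_graph G \<phi>" and T: "m \<in> T" "T \<subseteq> verts G" "card T \<ge> 2"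
  shows "(\<Sum>us | distinct us \<and> us \<noteq> [] \<and> hd us = m \<and> set us = T. cyclic_prod (gain_adjacency G \<phi>) us)
    = (\<Sum>C | C \<in> elementary_subgraphs G \<and> verts C = T. of_real_dual (elementary_re \<phi> C))"
    (is "sum ?A ?U = sum ?r ?E")
proof -
  have sG: "simple_graph G" using G by (simp add: dual_unit_gain_graph_def)
  have finT: "finite T" using T(3) by (metis card.infinite not_numeral_le_zero)
  have finE: "finite ?E"
    by (rule finite_subset[OF _ finite_subgraphs[OF sG]]) (auto simp: elementary_subgraphs_def)
  show ?thesis
  proof (cases "card T = 2")
    case True
    then obtain u where u: "T = {m, u}" "u \<noteq> m" using T(1) by (auto simp: card_2_iff)
    have U: "?U = {[m, u]}"
    proof (intro subset_antisym subsetI)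
      fix us assume us: "us \<in> ?U"
      then have "length us = 2" using True distinct_card by fastforce
      then show "us \<in> {[m, u]}" using us u by (auto simp: length_Suc_conv numeral_2_eq_2)
    qed (use u in auto)
    let ?K = "({m, u}, {{m, u}})"
    have nc: "\<not> is_cycle C" if "verts C = T" for C :: "nat graph"
      using is_cycle_card[of C] that True by auto
    have K2: "C = ?K" if "is_K2 C" "verts C = T" for C :: "nat graph"
    proof -
      obtain a b where "C = ({a, b}, {{a, b}})" using \<open>is_K2 C\<close> by (auto simp: is_K2_def)
      moreover from this have "{a, b} = {m, u}" using that u by simp
      ultimately show ?thesis by simp
    qed
    have K: "is_K2 ?K" using u by (auto simp: is_K2_def)
    have "C \<in> ?E \<longleftrightarrow> C = ?K \<and> {m, u} \<in> edges G" for C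
    proof
      assume C: "C \<in> ?E"
      then have "is_K2 C" using nc[of C] by (simp add: elementary_subgraphs_def elementary_graph_def)
      then have CK: "C = ?K" using K2 C by blast
      have "edges C \<subseteq> edges G" using C by (simp add: elementary_subgraphs_def subgraph_def)
      then show "C = ?K \<and> {m, u} \<in> edges G" unfolding CK by simp
    next
      assume C: "C = ?K \<and> {m, u} \<in> edges G"
      have "elementary_graph ?K" using K by (simp add: elementary_graph_def)
      moreover have "subgraph ?K G"
        using simple_graph_elementary[OF calculation] C T(2) by (simp add: subgraph_def u)
      ultimately show "C \<in> ?E" using C u by (simp add: elementary_subgraphs_def)
    qed
    then have "?E = (if {m, u} \<in> edges G then {?K} else {})" by auto
    moreover have "cyclic_prod (gain_adjacency G \<phi>) [m, u] = (if {m, u} \<in> edges G then 1 else 0)"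
      using G by (simp add: cyclic_prod_def gain_adjacency_def dual_unit_gain_graph_def insert_commute)
    ultimately show ?thesis
      unfolding U using nc[of ?K] u by (simp add: elementary_re_def of_real_dual_one)
  next
    case False
    then have T3: "card T \<ge> 3" using T by simp
    let ?gr = "\<lambda>us. (set us, cyclic_edges us)"
    let ?U' = "{us \<in> ?U. cyclic_edges us \<subseteq> edges G}"
    have finU: "finite ?U"
      by (rule finite_subset[OF _ finite_subset_distinct[OF finT]]) auto
    have len: "length us = card T" if "us \<in> ?U" for us
      using that distinct_card by fastforce
    have cyc: "is_cycle C" if "C \<in> ?E" for C
      using that T3 is_K2_card[of C] by (auto simp: elementary_subgraphs_def elementary_graph_def)
    have "sum ?A ?U = sum (cyclic_prod \<phi>) ?U'"
      unfolding cyclic_prod_gain_adjacency by (rule sum.inter_filter[OF finU, symmetric])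
    also have "\<dots> = (\<Sum>C\<in>?E. sum (cyclic_prod \<phi>) {us \<in> ?U'. ?gr us = C})"
    proof (rule sum.group[symmetric])
      show "finite ?U'" by (rule finite_subset[OF _ finU]) blast
      show "?gr ` ?U' \<subseteq> ?E"
      proof clarify
        fix us assume us: "distinct us" "us \<noteq> []" "T = set us" "m = hd us" "cyclic_edges us \<subseteq> edges G"
        have l3: "length us \<ge> 3" using T3 us distinct_card by fastforce
        then have "is_cycle (?gr us)" using us by (auto simp: is_cycle_def traversal_iff)
        moreover have "subgraph (?gr us) G"
          using simple_graph_cyclic_edges[OF us(1)] l3 us T(2) by (simp add: subgraph_def)
        ultimately show "?gr us \<in> elementary_subgraphs G \<and> verts (?gr us) = set us"
          by (simp add: elementary_subgraphs_def elementary_graph_def)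
      qed
    qed (rule finE)
    also have "\<dots> = sum ?r ?E"
    proof (rule sum.cong[OF refl])
      fix C assume C: "C \<in> ?E"
      have eG: "edges C \<subseteq> edges G" using C by (auto simp: elementary_subgraphs_def subgraph_def)
      have "{us \<in> ?U'. ?gr us = C} = {us. traversal us C \<and> hd us = m}"
        using C T3 eG len by (auto simp: traversal_iff)
      then have "sum (cyclic_prod \<phi>) {us \<in> ?U'. ?gr us = C} = of_real_dual (2 * cycle_re \<phi> C)"
      proof (simp only:, intro sum_traversals_from)
        show "is_cycle C" by (rule cyc[OF C])
        show "m \<in> verts C" using C T by simp
        fix a b assume "{a, b} \<in> edges C"
        then have "{a, b} \<in> edges G" using eG by blast
        then show "\<phi> b a = dual_conj (\<phi> a b)"
          using G by (intro unit_dual_inverse_eq_conj) (auto simp: dual_unit_gain_graph_def)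
      qed
      then show "sum (cyclic_prod \<phi>) {us \<in> ?U'. ?gr us = C} = ?r C"
        using cyc[OF C] by (simp add: elementary_re_def)
    qed
    finally show ?thesis .
  qed
qed


section \<open>Expansion over basic graphs\<close>

definition basic_weight :: "('v \<Rightarrow> 'v \<Rightarrow> 'a::gain_scalar dual) \<Rightarrow> 'v graph \<Rightarrow> real dual" where
  "basic_weight \<phi> B = (- 1) ^ num_components B * 2 ^ num_cycles B * basic_re \<phi> B"

lemma prod_elementary_weights:
  assumes F: "finite F" and el: "\<And>C. C \<in> F \<Longrightarrow> elementary_graph C"
    and dj: "\<And>C D. C \<in> F \<Longrightarrow> D \<in> F \<Longrightarrow> C \<noteq> D \<Longrightarrow> verts C \<inter> verts D = {}"
  shows "(\<Prod>C\<in>F. - (s ^ card (verts C) * elementary_re \<phi> C))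
    = s ^ card (verts (graph_union F)) * basic_weight \<phi> (graph_union F)"
proof -
  let ?Z = "{C \<in> F. is_cycle C}"
  have comp: "components (graph_union F) = F" by (rule components_graph_union[OF el dj])
  have "finite (verts C)" if "C \<in> F" for C
    using simple_graph_elementary[OF el[OF that]] by (simp add: simple_graph_def)
  then have "card (verts (graph_union F)) = (\<Sum>C\<in>F. card (verts C))"
    unfolding graph_union_def fst_conv using F dj by (intro card_UN_disjoint) auto
  then have 1: "(\<Prod>C\<in>F. s ^ card (verts C)) = s ^ card (verts (graph_union F))"
    by (simp add: power_sum)
  have "(\<Prod>C\<in>F. elementary_re \<phi> C) = (\<Prod>C\<in>?Z. 2 * cycle_re \<phi> C)"
    unfolding elementary_re_def using F by (simp add: prod.inter_filter)
  also have "\<dots> = 2 ^ card ?Z * (\<Prod>C\<in>?Z. cycle_re \<phi> C)" by (simp add: prod.distrib)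
  finally have 2: "(\<Prod>C\<in>F. elementary_re \<phi> C) = 2 ^ num_cycles (graph_union F) * basic_re \<phi> (graph_union F)"
    by (simp add: num_cycles_def basic_re_def comp)
  have "(\<Prod>C\<in>F. - (s ^ card (verts C) * elementary_re \<phi> C))
      = (\<Prod>C\<in>F. (- 1) * (s ^ card (verts C) * elementary_re \<phi> C))" by simp
  also have "\<dots> = (- 1) ^ card F * ((\<Prod>C\<in>F. s ^ card (verts C)) * (\<Prod>C\<in>F. elementary_re \<phi> C))"
    by (simp only: prod.distrib prod_constant)
  finally show ?thesis unfolding 1 2 by (simp add: basic_weight_def num_components_def comp mult_ac)
qed

theorem mdet_on_gain_adjacency:
  fixes \<phi> :: "nat \<Rightarrow> nat \<Rightarrow> 'a::gain_scalar dual" and h :: "'a dual \<Rightarrow> 'b::ring_1" and s :: int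
  assumes G: "dual_unit_gain_graph G \<phi>" and s: "s = 1 \<or> s = - 1"
    and h: "h 1 = 1" "\<And>a b. h (a * b) = h a * h b" "\<And>a b. h (a + b) = h a + h b"
    and x: "\<And>a. x * h a = h a * x"
  shows "mdet_on (verts G) (\<lambda>i j. (if i = j then x else 0) - of_int s * h (gain_adjacency G \<phi> i j)) =
    (\<Sum>B | subgraph B G \<and> basic_graph B. x ^ (card (verts G) - card (verts B)) *
       h (of_real_dual (of_int s ^ card (verts B) * basic_weight \<phi> B)))"
proof -
  let ?A = "gain_adjacency G \<phi>"
  let ?M = "\<lambda>i j. (if i = j then x else 0) - of_int s * h (?A i j)"
  let ?f = "\<lambda>r. h (of_real_dual r)"
  let ?w = "\<lambda>C. - (of_int s ^ card (verts C) * elementary_re \<phi> C) :: real dual"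
  let ?E = "elementary_subgraphs G"
  let ?F = "disjoint_families ?E verts (verts G)"
  have sG: "simple_graph G" using G by (simp add: dual_unit_gain_graph_def)
  then have finV: "finite (verts G)" by (simp add: simple_graph_def)
  have h0: "h 0 = 0" using h(3)[of 0 0] by simp
  have h_minus: "h (- a) = - h a" for a
    using h(3)[of a "- a"] h0 by (simp add: eq_neg_iff_add_eq_0 add.commute)
  have h_sum: "h (sum g X) = (\<Sum>a\<in>X. h (g a))" for g and X :: "'c set"
    by (induct X rule: infinite_finite_induct) (simp_all add: h0 h)
  have h_pow: "?f (of_int s ^ k * r) = of_int s ^ k * ?f r" for k r
    using s by (cases "even k") (auto simp: of_real_dual_minus h_minus)
  have "mdet_on (verts G) ?M = family_sum ?E verts x ?f ?w (verts G)"
  proof (rule mdet_on_eq_family_sum)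
    show "finite ?E"
      by (rule finite_subset[OF _ finite_subgraphs[OF sG]]) (auto simp: elementary_subgraphs_def)
    show "2 \<le> card (verts C)" if "C \<in> ?E" for C
      using that elementary_graph_card[of C] by (simp add: elementary_subgraphs_def)
    show "?f 1 = 1" by (simp add: of_real_dual_one h)
    show "?f (r * t) = ?f r * ?f t" for r t by (simp add: of_real_dual_mult h)
    show "?M m m = x" for m
      using sG by (auto simp: gain_adjacency_def simple_graph_def h0)
  next
    fix m T assume T: "m \<in> T" "T \<subseteq> verts G" "card T \<ge> 2"
    let ?U = "{us. distinct us \<and> us \<noteq> [] \<and> hd us = m \<and> set us = T}"
    have cM: "cyclic_prod ?M us = (- of_int s) ^ length us * h (cyclic_prod ?A us)"
      if "us \<in> ?U" for us
    proof -
      have us: "distinct us" "length us = card T" using that distinct_card by fastforce+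
      have "map (\<lambda>(a, b). ?M a b) (zip us (rotate1 us))
          = map (\<lambda>(a, b). - of_int s * h (?A a b)) (zip us (rotate1 us))"
      proof (rule map_cong[OF refl], clarify)
        fix a b assume ab: "(a, b) \<in> set (zip us (rotate1 us))"
        then have "{a, b} \<in> cyclic_edges us" by (force simp: cyclic_edges_def)
        then have "card {a, b} = 2"
          using simple_graph_cyclic_edges[OF us(1)] us T by (simp add: simple_graph_def)
        then have "a \<noteq> b" by auto
        then show "?M a b = - of_int s * h (?A a b)" by simp
      qed
      moreover have "prod_list (map (\<lambda>(a, b). - of_int s * h (?A a b)) ps)
          = (- of_int s) ^ length ps * h (prod_list (map (\<lambda>(a, b). ?A a b) ps))" for ps
      proof (induct ps)
        case (Cons p ps)
        obtain a b where p: "p = (a, b)" by fastforce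
        let ?H = "h (prod_list (map (\<lambda>(a, b). ?A a b) ps))"
        have "h (?A a b) * ((- of_int s) ^ length ps * ?H) = (- of_int s) ^ length ps * (h (?A a b) * ?H)"
          using s by (cases "even (length ps)") auto
        then show ?case
          by (simp only: p list.map prod_list.Cons prod.case Cons h(2) list.size(4) add_0_right
              add_Suc_right One_nat_def power_Suc mult.assoc)
      qed (simp add: h)
      ultimately show ?thesis by (simp only: cyclic_prod_zip) simp
    qed
    have sgn: "(- 1) ^ (k - 1) * (- of_int s) ^ k = (- (of_int s ^ k) :: 'b)" if "k \<ge> 2" for k
    proof -
      obtain j where "k = Suc j" using \<open>k \<ge> 2\<close> by (cases k) auto
      then show ?thesis using s by (cases "even j") auto
    qed
    have "cycle_sum ?M m T = (\<Sum>us\<in>?U. - (of_int s ^ card T) * h (cyclic_prod ?A us))"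
      unfolding cycle_sum_def
    proof (rule sum.cong[OF refl])
      fix us assume us: "us \<in> ?U"
      then have "length us = card T" using distinct_card by fastforce
      then show "(- 1) ^ (length us - 1) * cyclic_prod ?M us = - (of_int s ^ card T) * h (cyclic_prod ?A us)"
        using sgn[OF T(3)] cM[OF us] by (simp add: mult.assoc[symmetric])
    qed
    also have "\<dots> = - (of_int s ^ card T) * h (\<Sum>us\<in>?U. cyclic_prod ?A us)"
      by (simp only: h_sum sum_distrib_left)
    also have "\<dots> = (\<Sum>C | C \<in> ?E \<and> verts C = T. - (of_int s ^ card T) * ?f (elementary_re \<phi> C))"
      by (simp only: sum_cyclic_prod_gain_adjacency[OF G T] h_sum sum_distrib_left)
    also have "\<dots> = (\<Sum>C | C \<in> ?E \<and> verts C = T. ?f (?w C))"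
      by (intro sum.cong refl) (simp add: of_real_dual_minus h_minus h_pow)
    finally show "cycle_sum ?M m T = (\<Sum>C | C \<in> ?E \<and> verts C = T. ?f (?w C))" .
  qed (use finV x in auto)
  also have "\<dots> = (\<Sum>F\<in>?F. x ^ (card (verts G) - card (verts (graph_union F))) *
      ?f (of_int s ^ card (verts (graph_union F)) * basic_weight \<phi> (graph_union F)))"
    unfolding family_sum_def
  proof (rule sum.cong[OF refl])
    fix F assume F: "F \<in> ?F"
    then have "F \<subseteq> {H. subgraph H G}" by (auto simp: disjoint_families_def elementary_subgraphs_def)
    then have "finite F" by (rule finite_subset[OF _ finite_subgraphs[OF sG]])
    then have "(\<Prod>C\<in>F. ?w C) = of_int s ^ card (verts (graph_union F)) * basic_weight \<phi> (graph_union F)"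
      by (rule prod_elementary_weights)
        (use F in \<open>auto simp: disjoint_families_def elementary_subgraphs_def\<close>)
    moreover have "\<Union> (verts ` F) = verts (graph_union F)" by (simp add: graph_union_def)
    ultimately show "x ^ (card (verts G) - card (\<Union> (verts ` F))) * ?f (\<Prod>C\<in>F. ?w C)
        = x ^ (card (verts G) - card (verts (graph_union F))) *
          ?f (of_int s ^ card (verts (graph_union F)) * basic_weight \<phi> (graph_union F))"
      by (simp only:)
  qed
  also have "\<dots> = (\<Sum>B | subgraph B G \<and> basic_graph B. x ^ (card (verts G) - card (verts B)) *
       ?f (of_int s ^ card (verts B) * basic_weight \<phi> B))"
    by (rule sum.reindex_bij_betw[OF bij_betw_graph_union[OF sG]])
  finally show ?thesis .
qed

lemma poly_X_power: "(poly_X :: nat \<Rightarrow>\<^sub>0 'b::ring_1) ^ k = Poly_Mapping.single k 1"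
  by (induct k) (simp_all add: poly_X_def mult_single)

lemma poly_const_mult_poly_X_power: "poly_const a * poly_X ^ k = Poly_Mapping.single k a"
  by (simp add: poly_X_power poly_const_def mult_single)

lemma basic_subgraphs_0: "basic_subgraphs 0 G = {({}, {})}"
proof -
  have b: "basic_graph ({}, {})" by (auto simp: basic_graph_def intro!: exI[of _ "{}"])
  have empty: "B = ({}, {})" if "subgraph B G" "card (verts B) = 0" for B
  proof -
    have "verts B = {}" using that by (simp add: subgraph_def simple_graph_def)
    moreover have "edges B = {}"
      using that calculation by (auto simp: subgraph_def simple_graph_def)
    ultimately show ?thesis by (simp add: prod_eq_iff)
  qed
  have "subgraph ({}, {}) G" by (simp add: subgraph_def simple_graph_def)
  with b have mem: "({}, {}) \<in> basic_subgraphs 0 G" by (simp add: basic_subgraphs_def)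
  have sub: "B \<in> {({}, {})}" if "B \<in> basic_subgraphs 0 G" for B
  proof -
    have "subgraph B G" "card (verts B) = 0" using that by (simp_all add: basic_subgraphs_def)
    then have "B = ({}, {})" by (rule empty)
    then show ?thesis by (rule ssubst) (rule singletonI)
  qed
  show ?thesis
  proof (intro subset_antisym subsetI)
    show "B \<in> {({}, {})}" if "B \<in> basic_subgraphs 0 G" for B by (rule sub[OF that])
    show "B \<in> basic_subgraphs 0 G" if "B \<in> {({}, {})}" for B using mem that by simp
  qed
qed

lemma basic_weight_empty: "basic_weight \<phi> ({}, {}) = 1"
  by (simp add: basic_weight_def num_components_def num_cycles_def basic_re_def components_def)

lemma poly_coeffs_unique:
  fixes c d :: "nat \<Rightarrow> 'b::ring_1"
  assumes "(\<Sum>i = 1..n. poly_const (c i) * poly_X ^ (n - i)) = (\<Sum>i = 1..n. poly_const (d i) * poly_X ^ (n - i))"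
    and i: "i \<in> {1..n}"
  shows "c i = d i"
proof -
  have "Poly_Mapping.lookup (\<Sum>i = 1..n. poly_const (c i) * poly_X ^ (n - i)) (n - i) = c i" for c :: "nat \<Rightarrow> 'b"
  proof -
    have "Poly_Mapping.lookup (\<Sum>i = 1..n. poly_const (c i) * poly_X ^ (n - i)) (n - i)
        = (\<Sum>j = 1..n. if j = i then c j else 0)"
      unfolding poly_const_mult_poly_X_power lookup_sum lookup_single
      using i by (intro sum.cong refl) (auto simp: when_def)
    then show ?thesis using i by simp
  qed
  then show ?thesis using assms(1) by metis
qed

theorem theorem5p2:
  fixes n :: nat and G :: "nat graph" and \<phi> :: "nat \<Rightarrow> nat \<Rightarrow> 'a::gain_scalar dual"
  assumes "dual_unit_gain_graph G \<phi>" and "verts G = {1..n}"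
  shows "Mdet n (gain_adjacency G \<phi>) =
      of_real_dual (\<Sum>B \<in> basic_subgraphs n G.
        (- 1) ^ (n + num_components B) * 2 ^ num_cycles B * basic_re \<phi> B) \<and>
    (\<exists>c. moore_charpoly n (gain_adjacency G \<phi>) =
      poly_X ^ n + (\<Sum>i = 1..n. poly_const (c i) * poly_X ^ (n - i))) \<and>
    (\<forall>c. moore_charpoly n (gain_adjacency G \<phi>) =
        poly_X ^ n + (\<Sum>i = 1..n. poly_const (c i) * poly_X ^ (n - i)) \<longrightarrow>
      (\<forall>i \<in> {1..n}. c i =
        of_real_dual (\<Sum>B \<in> basic_subgraphs i G.
          (- 1) ^ num_components B * 2 ^ num_cycles B * basic_re \<phi> B)))"
proof -
  let ?A = "gain_adjacency G \<phi>"
  let ?BG = "{B. subgraph B G \<and> basic_graph B}"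
  define d where "d i = (of_real_dual (\<Sum>B \<in> basic_subgraphs i G. basic_weight \<phi> B) :: 'a dual)" for i
  have sG: "simple_graph G" using assms(1) by (simp add: dual_unit_gain_graph_def)
  have fin: "finite ?BG" by (rule finite_subset[OF _ finite_subgraphs[OF sG]]) auto
  have BG: "basic_subgraphs i G = {B \<in> ?BG. card (verts B) = i}" for i
    by (auto simp: basic_subgraphs_def)
  have le: "card (verts B) \<le> n" if "B \<in> ?BG" for B
    using that card_mono[of "{1..n}" "verts B"] by (simp add: subgraph_def assms(2))

  have "Mdet n ?A = mdet_on (verts G) (\<lambda>i j. (if i = j then 0 else 0) - of_int (- 1) * id (?A i j))"
    by (simp add: Mdet_eq_mdet_on assms(2))
  also have "\<dots> = (\<Sum>B\<in>?BG. 0 ^ (card (verts G) - card (verts B)) *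
      id (of_real_dual (of_int (- 1) ^ card (verts B) * basic_weight \<phi> B)))"
    by (rule mdet_on_gain_adjacency[OF assms(1)]) simp_all
  also have "\<dots> = (\<Sum>B\<in>?BG. if card (verts B) = n then
      of_real_dual ((- 1) ^ (n + num_components B) * 2 ^ num_cycles B * basic_re \<phi> B) else 0)"
  proof (rule sum.cong[OF refl])
    fix B assume "B \<in> ?BG"
    then show "0 ^ (card (verts G) - card (verts B)) *
        id (of_real_dual (of_int (- 1) ^ card (verts B) * basic_weight \<phi> B)) = (if card (verts B) = n then
      of_real_dual ((- 1) ^ (n + num_components B) * 2 ^ num_cycles B * basic_re \<phi> B) else (0 :: 'a dual))"
      using le[of B] by (auto simp: assms(2) basic_weight_def power_add mult.assoc zero_power)
  qed
  also have "\<dots> = of_real_dual (\<Sum>B \<in> basic_subgraphs n G.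
      (- 1) ^ (n + num_components B) * 2 ^ num_cycles B * basic_re \<phi> B)"
    unfolding BG of_real_dual_sum by (rule sum.inter_filter[OF fin, symmetric])
  finally have Mdet: "Mdet n ?A = of_real_dual (\<Sum>B \<in> basic_subgraphs n G.
      (- 1) ^ (n + num_components B) * 2 ^ num_cycles B * basic_re \<phi> B)" .

  have pc: "poly_const (a + b) = poly_const a + poly_const b" for a b :: "'a dual"
    by (simp add: poly_const_def single_add)
  have pc0: "poly_const 0 = (0 :: nat \<Rightarrow>\<^sub>0 'a dual)" by (simp add: poly_const_def)
  have pc_sum: "poly_const (sum g X) = (\<Sum>a\<in>X. poly_const (g a))" for g :: "'c \<Rightarrow> 'a dual" and X
    by (induct X rule: infinite_finite_induct) (simp_all add: pc pc0)
  have cX: "poly_X * poly_const a = poly_const a * poly_X" for a :: "'a dual"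
    by (simp add: poly_X_def poly_const_def mult_single)
  have "moore_charpoly n ?A =
      mdet_on (verts G) (\<lambda>i j. (if i = j then poly_X else 0) - of_int 1 * poly_const (?A i j))"
    by (simp add: moore_charpoly_def Mdet_eq_mdet_on assms(2))
  also have "\<dots> = (\<Sum>B\<in>?BG. poly_X ^ (card (verts G) - card (verts B)) *
      poly_const (of_real_dual (of_int 1 ^ card (verts B) * basic_weight \<phi> B)))"
    by (rule mdet_on_gain_adjacency[OF assms(1)])
      (simp_all add: pc cX, simp_all add: poly_const_def mult_single)
  also have "\<dots> = (\<Sum>B\<in>?BG. poly_const (of_real_dual (basic_weight \<phi> B)) * poly_X ^ (n - card (verts B)))"
    by (simp add: assms(2) power_commuting_commutes[OF cX])
  also have "\<dots> = (\<Sum>i = 0..n. \<Sum>B\<in>{B \<in> ?BG. card (verts B) = i}.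
      poly_const (of_real_dual (basic_weight \<phi> B)) * poly_X ^ (n - card (verts B)))"
    by (rule sum.group[symmetric]) (use fin le in auto)
  also have "\<dots> = (\<Sum>i = 0..n. poly_const (d i) * poly_X ^ (n - i))"
    unfolding d_def of_real_dual_sum pc_sum sum_distrib_right BG
    by (intro sum.cong refl) auto
  also have "\<dots> = poly_const (d 0) * poly_X ^ n + (\<Sum>i = 1..n. poly_const (d i) * poly_X ^ (n - i))"
    by (simp add: sum.atLeast_Suc_atMost)
  also have "d 0 = 1"
    by (simp add: d_def basic_subgraphs_0 basic_weight_empty of_real_dual_one)
  finally have charpoly: "moore_charpoly n ?A = poly_X ^ n + (\<Sum>i = 1..n. poly_const (d i) * poly_X ^ (n - i))"
    by (simp add: poly_const_def)
  have "c i = of_real_dual (\<Sum>B \<in> basic_subgraphs i G.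
      (- 1) ^ num_components B * 2 ^ num_cycles B * basic_re \<phi> B)"
    if "moore_charpoly n ?A = poly_X ^ n + (\<Sum>i = 1..n. poly_const (c i) * poly_X ^ (n - i))"
      and "i \<in> {1..n}" for c i
    using poly_coeffs_unique[of c n d i] that charpoly by (simp add: d_def basic_weight_def)
  then show ?thesis using Mdet charpoly by blast
qed

end
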